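(* Let $K$ be a closed subset of $\mathbb{R}^d$ and let $\mu\in\mathcal{M}(K)$. Let $\varphi=(\varphi_1,\dots,\varphi_m):\mathbb{R}^d\to\mathbb{R}^m$ be a polynomial mapping, where $\varphi_1,\dots,\varphi_m\in\mathbb{R}[x_1,\dots,x_d]$. Suppose that the restriction $\varphi:K\to\mathbb{R}^m$ is injective and that for each $k=1,\dots,m$ one of the following (mutually equivalent) conditions is satisfied: (a) the measure $\varphi_k(\mu)\in\mathcal{M}(\mathbb{R})$ is determinate (on $\mathbb{R}$); (b) there exist some $z\in\mathbb{C}\setminus\mathbb{R}$ and a sequence $\{q_{kn};n\in\mathbb{N}\}$ of polynomials in one variable, $q_{kn}\in\mathbb{C}[y_1]$, such that $(\varphi_k(x)+z)\,q_{kn}(\varphi_k(x))\to 1$ in $\mathfrak{H}_{L_\mu}$ as $n\to\infty$, i.e. $L_\mu\big(|(\varphi_k+z)q_{kn}(\varphi_k)-1|^2\big)\to 0$; (c) for some $z\in\mathbb{C}\setminus\mathbb{R}$ the set $(\varphi_k+z)\mathbb{C}[\varphi_k]$, i.e. the set of polynomials $(t+z)\mathbb{C}[t]$ in the variable $t=\varphi_k$, is dense in $L^2(\varphi_k(\mu))$. Then $\mu$ is determinate on $K$.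
   Context: $\mathcal{M}(\mathbb{R}^d)$ is the set of positive Borel measures $\mu$ on $\mathbb{R}^d$ such that $x^\alpha\in L^1(\mu)$ for all $\alpha\in\mathbb{N}_0^d$; for a closed set $K\subseteq\mathbb{R}^d$, $\mathcal{M}(K)$ is the set of $\mu\in\mathcal{M}(\mathbb{R}^d)$ with $\operatorname{supp}\mu\subseteq K$. The moment functional of $\mu$ is $L_\mu(p)=\int p\,d\mu$, $p\in\mathbb{C}[x_1,\dots,x_d]$. Two measures $\mu,\nu\in\mathcal{M}(\mathbb{R}^d)$ are equivalent, $\mu\cong\nu$, if $L_\mu=L_\nu$. A measure $\mu\in\mathcal{M}(K)$ is determinate on $K$ if every $\nu\in\mathcal{M}(K)$ with $\nu\cong\mu$ equals $\mu$. $\mathfrak{H}_{L_\mu}$ is the Hilbert space completion of $\mathbb{C}[x_1,\dots,x_d]$ modulo $\{p:L_\mu(p\overline p)=0\}$ with scalar product $\langle p,q\rangle=L_\mu(p\overline q)$. For a Borel map $\psi:\mathbb{R}^d\to\mathbb{R}^l$, $\psi(\mu)$ denotes the image measure $\psi(\mu)(M)=\mu(\psi^{-1}(M))$. *)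

theory Defs
  imports "HOL-Analysis.Analysis" "HOL-Computational_Algebra.Polynomial"
begin

text \<open>
  The real line and \<open>\<real>\<^sup>d\<close> are both treated as euclidean spaces.  Elements of
  \<open>\<complex>[x\<^sub>1,\<dots>,x\<^sub>d]\<close> are represented by the functions \<open>p :: 'a \<Rightarrow> complex\<close> with
  \<^term>\<open>polynomial_function p\<close>; since the field of real numbers is infinite, a polynomial is
  determined by its values on \<open>\<real>\<^sup>d\<close>.
\<close>

definition measure_support :: "'a::topological_space measure \<Rightarrow> 'a set" where
  "measure_support \<mu> = {x. \<forall>U. open U \<and> x \<in> U \<longrightarrow> emeasure \<mu> U > 0}"

text \<open>
  The multi-index \<open>\<alpha>\<close> assigns an exponent to each coordinate \<open>x \<bullet> b\<close>; its values outside
  \<^term>\<open>Basis\<close> are irrelevant.  The zero multi-index forces the measures to be finite.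
\<close>

definition moment_measures :: "'a::euclidean_space measure set" where
  "moment_measures =
    {\<mu>. sets \<mu> = sets borel \<and>
        (\<forall>\<alpha>::'a \<Rightarrow> nat. integrable \<mu> (\<lambda>x. \<Prod>b\<in>Basis. (x \<bullet> b) ^ \<alpha> b))}"

definition moment_measures_on :: "'a::euclidean_space set \<Rightarrow> 'a measure set" where
  "moment_measures_on K = {\<mu> \<in> moment_measures. measure_support \<mu> \<subseteq> K}"

definition moment_functional :: "'a::euclidean_space measure \<Rightarrow> ('a \<Rightarrow> complex) \<Rightarrow> complex" where
  "moment_functional \<mu> p = integral\<^sup>L \<mu> p"

definition moment_equivalent :: "'a::euclidean_space measure \<Rightarrow> 'a measure \<Rightarrow> bool"
    (infix "\<cong>\<^sub>m" 50) where
  "\<mu> \<cong>\<^sub>m \<nu> \<longleftrightarrow>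
    (\<forall>p. polynomial_function p \<longrightarrow> moment_functional \<mu> p = moment_functional \<nu> p)"

definition determinate_on :: "'a::euclidean_space set \<Rightarrow> 'a measure \<Rightarrow> bool" where
  "determinate_on K \<mu> \<longleftrightarrow>
    \<mu> \<in> moment_measures_on K \<and> (\<forall>\<nu>\<in>moment_measures_on K. \<nu> \<cong>\<^sub>m \<mu> \<longrightarrow> \<nu> = \<mu>)"

text \<open>
  The scalar product and seminorm on polynomials whose Hilbert space completion (modulo the
  null space) is \<open>\<HH>\<^sub>L\<close> for \<open>L = L\<^sub>\<mu>\<close>.  For polynomials, convergence of the classes in \<open>\<HH>\<^sub>L\<close> is
  convergence in this seminorm.
\<close>

definition moment_inner ::
    "'a::euclidean_space measure \<Rightarrow> ('a \<Rightarrow> complex) \<Rightarrow> ('a \<Rightarrow> complex) \<Rightarrow> complex" where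
  "moment_inner \<mu> p q = moment_functional \<mu> (\<lambda>x. p x * cnj (q x))"

definition moment_norm :: "'a::euclidean_space measure \<Rightarrow> ('a \<Rightarrow> complex) \<Rightarrow> real" where
  "moment_norm \<mu> p = sqrt (Re (moment_inner \<mu> p p))"

definition moment_tendsto ::
    "'a::euclidean_space measure \<Rightarrow> (nat \<Rightarrow> 'a \<Rightarrow> complex) \<Rightarrow> ('a \<Rightarrow> complex) \<Rightarrow> bool" where
  "moment_tendsto \<mu> p q \<longleftrightarrow> (\<lambda>n. moment_norm \<mu> (\<lambda>x. p n x - q x)) \<longlonglongrightarrow> 0"

definition L2_functions :: "'a measure \<Rightarrow> ('a \<Rightarrow> complex) set" where
  "L2_functions M =
    {f. f \<in> borel_measurable M \<and> integrable M (\<lambda>x. (cmod (f x))\<^sup>2)}"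

definition L2_dense :: "'a measure \<Rightarrow> ('a \<Rightarrow> complex) set \<Rightarrow> bool" where
  "L2_dense M S \<longleftrightarrow> S \<subseteq> L2_functions M \<and>
    (\<forall>f\<in>L2_functions M. \<forall>\<epsilon>>0. \<exists>g\<in>S. sqrt (\<integral>x. (cmod (f x - g x))\<^sup>2 \<partial>M) < \<epsilon>)"

definition image_determinate ::
    "'a::euclidean_space measure \<Rightarrow> ('a \<Rightarrow> real) \<Rightarrow> bool" where
  "image_determinate \<mu> f \<longleftrightarrow> determinate_on UNIV (distr \<mu> borel f)"

definition one_approximable ::
    "'a::euclidean_space measure \<Rightarrow> ('a \<Rightarrow> real) \<Rightarrow> bool" where
  "one_approximable \<mu> f \<longleftrightarrow>
    (\<exists>z. z \<notin> \<real> \<and>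
      (\<exists>q :: nat \<Rightarrow> complex poly.
        moment_tendsto \<mu>
          (\<lambda>n x. (complex_of_real (f x) + z) * poly (q n) (complex_of_real (f x))) (\<lambda>x. 1)))"

definition image_multiples_dense ::
    "'a::euclidean_space measure \<Rightarrow> ('a \<Rightarrow> real) \<Rightarrow> bool" where
  "image_multiples_dense \<mu> f \<longleftrightarrow>
    (\<exists>z. z \<notin> \<real> \<and>
      L2_dense (distr \<mu> borel f)
        (range (\<lambda>(q :: complex poly) t. (complex_of_real t + z) * poly q (complex_of_real t))))"

end

theory Submission
  imports Defs "HOL-Computational_Algebra.Fundamental_Theorem_Algebra"
begin

text \<open>
Let \<open>\<rho>\<close> be the image of \<open>\<mu>\<close> under one coordinate \<open>f = \<phi>\<^sub>k\<close>.  Everything turns on the condition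
that, for some nonreal \<open>z\<close>, the constant \<open>1\<close> lies in the \<open>L\<^sup>2(\<rho>)\<close>-closure of \<open>(t + z)\<complex>[t]\<close>
(\<open>one_in_multiples_closure\<close>).  Condition (b) is this condition pulled back along \<open>f\<close>.

Density.  Dividing by \<open>t + z\<close> shows that \<open>1 / (t + z)\<close> is a limit of polynomials.  As
\<open>p(t) = (t + z) r(t) + p(-z)\<close>, the closure \<open>H\<close> of the polynomials is then stable under
multiplication by the bounded function \<open>1 / (t + z)\<close> and, by conjugation, by its conjugate.
The Stone--Weierstrass theorem on a disc puts every continuous function of \<open>1 / (t + z)\<close> into \<open>H\<close>,
and dominated convergence adds the indicators of intervals, then of Borel sets, so that \<open>H\<close> is all
of \<open>L\<^sup>2\<close>; this is (c).  The hypothesis only speaks of moments: the same polynomials work for every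
measure with the moments of \<open>\<rho>\<close>.  All approximations are therefore carried out jointly for a
finite family of measures.  If \<open>\<nu>\<close> has the moments of \<open>\<rho>\<close>, an indicator is approximated by the
same polynomials for \<open>\<nu>\<close> and for \<open>\<rho>\<close>, so the two measures agree; this is (a).

From (a) to (b).  Let \<open>\<rho>\<close> be determinate and let \<open>x\<^sub>0\<close> be no atom of \<open>\<rho>\<close>.  If some \<open>c > 0\<close> had
\<open>\<integral>q d\<rho> \<ge> c q(x\<^sub>0)\<close> for all polynomials \<open>q \<ge> 0\<close> on the line, then \<open>q \<mapsto> \<integral>q d\<rho> - c q(x\<^sub>0)\<close> would extend to a
positive functional on all functions of polynomial growth (\<open>M_Riesz_extension\<close>).  Adding \<open>c\<close> times
evaluation at \<open>x\<^sub>0\<close> back and representing the sum by a measure gives a measure with the moments of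
\<open>\<rho>\<close> and an atom at \<open>x\<^sub>0\<close>, which is impossible.  Hence \<open>\<integral>q d\<rho> / q(x\<^sub>0)\<close> can be made arbitrarily small.
Write \<open>q = |s|\<^sup>2\<close> on the line with all zeros of \<open>s\<close> in the closed lower half plane
(\<open>nonneg_poly_factorization\<close>).  Moving upwards from \<open>x\<^sub>0\<close> then increases the distance to every zero,
so \<open>|s(x\<^sub>0 + \<i>)| \<ge> |s(x\<^sub>0)|\<close>, and \<open>1 - s / s(x\<^sub>0 + \<i>)\<close> is a polynomial multiple of \<open>t - x\<^sub>0 - \<i>\<close> that is
close to \<open>1\<close> in \<open>L\<^sup>2(\<rho>)\<close>.

Several variables.  Let \<open>\<nu>\<close> have the moments of \<open>\<mu>\<close>.  The indicator of a set
\<open>{x. \<phi>\<^sub>k x \<in> A\<^sub>k for all k}\<close> is approximated by polynomials in \<open>L\<^sup>1(\<mu>)\<close> and \<open>L\<^sup>1(\<nu>)\<close> at once, replacing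
one factor at a time: the error of the new factor is small in \<open>L\<^sup>2\<close> while the factors already
replaced form a fixed polynomial, which is in \<open>L\<^sup>2\<close> (\<open>indicator_product_L1_approximable\<close>).  Thus
\<open>\<phi>(\<mu>) = \<phi>(\<nu>)\<close>.  Both measures live on \<open>K\<close>, where \<open>\<phi>\<close> is injective, and a compact part of \<open>K\<close> is the
preimage in \<open>K\<close> of its compact image; so \<open>\<mu>\<close> and \<open>\<nu>\<close> agree on compact sets.
\<close>

section \<open>Linear functionals below sublinear ones\<close>

definition function_space :: "('a \<Rightarrow> real) set \<Rightarrow> bool" where
  "function_space V \<longleftrightarrow> (\<lambda>_. 0) \<in> V \<and> (\<forall>f\<in>V. \<forall>g\<in>V. (\<lambda>x. f x + g x) \<in> V) \<and>
     (\<forall>f\<in>V. \<forall>c. (\<lambda>x. c * f x) \<in> V)"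

definition linear_functional_on :: "('a \<Rightarrow> real) set \<Rightarrow> (('a \<Rightarrow> real) \<Rightarrow> real) \<Rightarrow> bool" where
  "linear_functional_on V \<Lambda> \<longleftrightarrow> (\<forall>f\<in>V. \<forall>g\<in>V. \<Lambda> (\<lambda>x. f x + g x) = \<Lambda> f + \<Lambda> g) \<and>
     (\<forall>f\<in>V. \<forall>c. \<Lambda> (\<lambda>x. c * f x) = c * \<Lambda> f)"

text \<open>
Homogeneity is only demanded as an inequality for \<open>c > 0\<close>, which is what infima of sublinear
functionals satisfy directly; equality follows (\<open>sublinear_on_scale\<close>).
\<close>

definition sublinear_on :: "('a \<Rightarrow> real) set \<Rightarrow> (('a \<Rightarrow> real) \<Rightarrow> real) \<Rightarrow> bool" where
  "sublinear_on V p \<longleftrightarrow> (\<forall>f\<in>V. \<forall>g\<in>V. p (\<lambda>x. f x + g x) \<le> p f + p g) \<and>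
     (\<forall>f\<in>V. \<forall>c>0. p (\<lambda>x. c * f x) \<le> c * p f) \<and> p (\<lambda>_. 0) = 0"

lemma function_spaceD:
  assumes "function_space V"
  shows "(\<lambda>_. 0) \<in> V"
    and "f \<in> V \<Longrightarrow> g \<in> V \<Longrightarrow> (\<lambda>x. f x + g x) \<in> V"
    and "f \<in> V \<Longrightarrow> (\<lambda>x. c * f x) \<in> V"
    and "f \<in> V \<Longrightarrow> (\<lambda>x. - f x) \<in> V"
proof -
  show sc: "f \<in> V \<Longrightarrow> (\<lambda>x. c * f x) \<in> V" for f c
    using assms unfolding function_space_def by blast
  show "f \<in> V \<Longrightarrow> (\<lambda>x. - f x) \<in> V" using sc[of f "-1"] by simp
qed (use assms in \<open>auto simp: function_space_def\<close>)

lemma sublinear_onD: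
  assumes "sublinear_on V p"
  shows "f \<in> V \<Longrightarrow> g \<in> V \<Longrightarrow> p (\<lambda>x. f x + g x) \<le> p f + p g"
    and "f \<in> V \<Longrightarrow> c > 0 \<Longrightarrow> p (\<lambda>x. c * f x) \<le> c * p f"
    and "p (\<lambda>_. 0) = 0"
proof -
  note p = assms[unfolded sublinear_on_def]
  show "f \<in> V \<Longrightarrow> g \<in> V \<Longrightarrow> p (\<lambda>x. f x + g x) \<le> p f + p g"
    using p[THEN conjunct1, THEN bspec, of f, THEN bspec, of g] .
  show "f \<in> V \<Longrightarrow> c > 0 \<Longrightarrow> p (\<lambda>x. c * f x) \<le> c * p f"
    using p[THEN conjunct2, THEN conjunct1, THEN bspec, of f, rule_format, of c] .
  show "p (\<lambda>_. 0) = 0" using p[THEN conjunct2, THEN conjunct2] .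
qed

lemma sublinear_on_scale:
  assumes "function_space V" "sublinear_on V p" "f \<in> V" "c \<ge> 0"
  shows "p (\<lambda>x. c * f x) = c * p f"
proof (cases "c = 0")
  case True
  then show ?thesis using sublinear_onD(3)[OF assms(2)] by simp
next
  case False
  then have c: "c > 0" using assms by simp
  have cf: "(\<lambda>x. c * f x) \<in> V" by (intro function_spaceD[OF assms(1)] assms(3))
  have "p (\<lambda>x. (1/c) * (c * f x)) \<le> (1/c) * p (\<lambda>x. c * f x)"
    by (rule sublinear_onD(2)[OF assms(2) cf]) (use c in simp)
  then have "c * p f \<le> p (\<lambda>x. c * f x)"
    using c by (simp add: field_simps)
  moreover have "p (\<lambda>x. c * f x) \<le> c * p f"
    by (rule sublinear_onD(2)[OF assms(2,3) c])
  ultimately show ?thesis by simp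
qed

lemma sublinear_on_ge_uminus:
  assumes "function_space V" "sublinear_on V p" "f \<in> V"
  shows "- p (\<lambda>x. - f x) \<le> p f"
proof -
  have "(\<lambda>x. - f x) \<in> V" by (rule function_spaceD(4)[OF assms(1,3)])
  then have "p (\<lambda>x. f x + - f x) \<le> p f + p (\<lambda>x. - f x)"
    by (rule sublinear_onD(1)[OF assms(2,3)])
  then show ?thesis using sublinear_onD(3)[OF assms(2)] by simp
qed

text \<open>
The chain condition enters in subadditivity: of two members of the chain the smaller one serves
both summands.  The infimum is finite because each member satisfies \<open>p f \<ge> - p (- f) \<ge> - P (- f)\<close>.
\<close>

lemma sublinear_on_chain_Inf:
  assumes V: "function_space V" and C: "C \<noteq> {}"
    and sub: "\<And>p. p \<in> C \<Longrightarrow> sublinear_on V p"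
    and le: "\<And>p f. p \<in> C \<Longrightarrow> f \<in> V \<Longrightarrow> p f \<le> P f"
    and chain: "\<And>p q. p \<in> C \<Longrightarrow> q \<in> C \<Longrightarrow> p \<le> q \<or> q \<le> p"
  shows "sublinear_on V (\<lambda>f. INF p\<in>C. p f)" and "f \<in> V \<Longrightarrow> bdd_below ((\<lambda>p. p f) ` C)"
proof -
  have bdd: "bdd_below ((\<lambda>p. p f) ` C)" if f: "f \<in> V" for f
  proof (rule bdd_belowI2)
    fix p assume p: "p \<in> C"
    have "(\<lambda>x. - f x) \<in> V" by (rule function_spaceD(4)[OF V f])
    then show "- P (\<lambda>x. - f x) \<le> p f"
      using sublinear_on_ge_uminus[OF V sub[OF p] f] le[OF p, of "\<lambda>x. - f x"] by linarith
  qed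
  then show "f \<in> V \<Longrightarrow> bdd_below ((\<lambda>p. p f) ` C)" .
  show "sublinear_on V (\<lambda>f. INF p\<in>C. p f)"
    unfolding sublinear_on_def
  proof (intro conjI ballI allI impI)
    fix f g assume f: "f \<in> V" and g: "g \<in> V"
    then have fg: "(\<lambda>x. f x + g x) \<in> V" by (intro function_spaceD[OF V] f g)
    have *: "(INF p\<in>C. p (\<lambda>x. f x + g x)) \<le> p f + q g" if p: "p \<in> C" and q: "q \<in> C" for p q
    proof -
      obtain r where r: "r \<in> C" "r \<le> p" "r \<le> q"
        using chain[OF p q] p q by blast
      have "(INF p\<in>C. p (\<lambda>x. f x + g x)) \<le> r (\<lambda>x. f x + g x)"
        by (rule cINF_lower[OF bdd[OF fg] r(1)])
      also have "\<dots> \<le> r f + r g" using sublinear_onD(1)[OF sub[OF r(1)] f g] .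
      also have "\<dots> \<le> p f + q g" using r by (simp add: le_fun_def add_mono)
      finally show ?thesis .
    qed
    have "(INF p\<in>C. p (\<lambda>x. f x + g x)) - q g \<le> (INF p\<in>C. p f)" if q: "q \<in> C" for q
      by (rule cINF_greatest[OF C]) (use *[OF _ q] in \<open>simp add: diff_le_eq\<close>)
    then have "(INF p\<in>C. p (\<lambda>x. f x + g x)) - (INF p\<in>C. p f) \<le> (INF p\<in>C. p g)"
      by (intro cINF_greatest[OF C]) (simp add: algebra_simps)
    then show "(INF p\<in>C. p (\<lambda>x. f x + g x)) \<le> (INF p\<in>C. p f) + (INF p\<in>C. p g)"
      by linarith
  next
    fix f c assume f: "f \<in> V" and c: "c > (0::real)"
    then have cf: "(\<lambda>x. c * f x) \<in> V" by (intro function_spaceD[OF V] f)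
    have "(INF p\<in>C. p (\<lambda>x. c * f x)) / c \<le> (INF p\<in>C. p f)"
    proof (rule cINF_greatest[OF C])
      fix p assume p: "p \<in> C"
      have "(INF p\<in>C. p (\<lambda>x. c * f x)) \<le> p (\<lambda>x. c * f x)"
        by (rule cINF_lower[OF bdd[OF cf] p])
      also have "\<dots> \<le> c * p f" using sublinear_onD(2)[OF sub[OF p] f c] .
      finally show "(INF p\<in>C. p (\<lambda>x. c * f x)) / c \<le> p f" using c by (simp add: field_simps)
    qed
    then show "(INF p\<in>C. p (\<lambda>x. c * f x)) \<le> c * (INF p\<in>C. p f)"
      using c by (simp add: field_simps)
  next
    have "(INF p\<in>C. p (\<lambda>_. 0)) = (INF p\<in>C. 0::real)"
      by (intro INF_cong) (simp_all add: sublinear_onD(3)[OF sub])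
    then show "(INF p\<in>C. p (\<lambda>_. 0)) = 0" using C by simp
  qed
qed

text \<open>
Zorn's lemma.  Functionals are set to \<open>0\<close> outside \<open>V\<close> inside the proof, so that the pointwise
order on them is antisymmetric.
\<close>

lemma minimal_sublinear_below:
  assumes V: "function_space V" and P: "sublinear_on V P"
  obtains p where "sublinear_on V p" "\<And>f. f \<in> V \<Longrightarrow> p f \<le> P f"
    "\<And>q. sublinear_on V q \<Longrightarrow> (\<And>f. f \<in> V \<Longrightarrow> q f \<le> p f) \<Longrightarrow> \<forall>f\<in>V. q f = p f"
proof -
  define A where "A = {p. sublinear_on V p \<and> (\<forall>f\<in>V. p f \<le> P f) \<and> (\<forall>f. f \<notin> V \<longrightarrow> p f = 0)}"
  define R where "R = (\<lambda>p q :: ('a \<Rightarrow> real) \<Rightarrow> real. q \<le> p)"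
  have restrict: "sublinear_on V (\<lambda>f. if f \<in> V then q f else 0)" if "sublinear_on V q" for q
    unfolding sublinear_on_def
    by (simp add: function_spaceD(1-3)[OF V] sublinear_onD[OF that])
  have "\<exists>m\<in>A. \<forall>a\<in>A. R m a \<longrightarrow> a = m"
  proof (rule predicate_Zorn)
    show "partial_order_on A (relation_of R A)"
      by (rule partial_order_on_relation_ofI) (auto simp: R_def)
    fix C assume "C \<in> Chains (relation_of R A)"
    then have CA: "C \<subseteq> A" and chain: "\<And>p q. p \<in> C \<Longrightarrow> q \<in> C \<Longrightarrow> p \<le> q \<or> q \<le> p"
      by (auto simp: Chains_def relation_of_def R_def)
    show "\<exists>u\<in>A. \<forall>a\<in>C. R a u"
    proof (cases "C = {}")
      case True
      have "(\<lambda>f. if f \<in> V then P f else 0) \<in> A"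
        using restrict[OF P] by (simp add: A_def)
      then show ?thesis using True by blast
    next
      case False
      have C: "\<And>p. p \<in> C \<Longrightarrow> sublinear_on V p" "\<And>p f. p \<in> C \<Longrightarrow> f \<in> V \<Longrightarrow> p f \<le> P f"
        using CA by (auto simp: A_def)
      have sub: "sublinear_on V (\<lambda>f. INF p\<in>C. p f)"
        by (rule sublinear_on_chain_Inf(1)[where P = P]) (use V False C chain in auto)
      have bdd: "bdd_below ((\<lambda>p. p f) ` C)" if "f \<in> V" for f
        by (rule sublinear_on_chain_Inf(2)[where P = P and V = V]) (use V False C chain that in auto)
      let ?u = "\<lambda>f. if f \<in> V then INF p\<in>C. p f else 0"
      have le: "?u f \<le> p f" if "p \<in> C" for p f
        using that CA cINF_lower[OF bdd that] by (auto simp: A_def)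
      obtain p where p: "p \<in> C" using False by blast
      have "?u \<in> A"
        unfolding A_def
      proof (safe)
        show "sublinear_on V ?u" by (rule restrict[OF sub])
        fix f assume "f \<in> V"
        then have "p f \<le> P f" using p CA by (auto simp: A_def)
        then show "?u f \<le> P f" using le[OF p, of f] by linarith
      qed auto
      moreover have "R a ?u" if "a \<in> C" for a
        using le[OF that] by (simp add: R_def le_fun_def)
      ultimately show ?thesis by blast
    qed
  qed
  then obtain p where p: "p \<in> A" and min: "\<And>q. q \<in> A \<Longrightarrow> q \<le> p \<Longrightarrow> q = p"
    by (auto simp: R_def)
  show thesis
  proof (rule that)
    show "sublinear_on V p" "\<And>f. f \<in> V \<Longrightarrow> p f \<le> P f" using p by (auto simp: A_def)
    fix q assume q: "sublinear_on V q" "\<And>f. f \<in> V \<Longrightarrow> q f \<le> p f"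
    let ?q = "\<lambda>f. if f \<in> V then q f else 0"
    have pP: "p f \<le> P f" if "f \<in> V" for f using p that by (simp add: A_def)
    have p0: "p f = 0" if "f \<notin> V" for f using p that by (simp add: A_def)
    have "?q f \<le> P f" if "f \<in> V" for f
      using order_trans[OF q(2)[OF that] pP[OF that]] that by simp
    then have "?q \<in> A" using restrict[OF q(1)] by (simp add: A_def)
    moreover have "?q f \<le> p f" for f using q(2)[of f] p0[of f] by (cases "f \<in> V") simp_all
    then have "?q \<le> p" by (rule le_funI)
    ultimately have eq: "?q = p" by (rule min)
    have "q f = p f" if "f \<in> V" for f
      using fun_cong[OF eq, of f] that by simp
    then show "\<forall>f\<in>V. q f = p f" by blast
  qed
qed

text \<open>
The functional \<open>q\<close> is sublinear, lies below \<open>p\<close>, and splits off \<open>g\<close>.  If \<open>p\<close> is minimal, then \<open>q = p\<close>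
and the second estimate becomes the missing half of additivity.
\<close>

lemma sublinear_on_shift:
  assumes V: "function_space V" and p: "sublinear_on V p" and g: "g \<in> V"
  defines "q \<equiv> \<lambda>f. INF t\<in>{0::real..}. p (\<lambda>x. f x + t * g x) - t * p g"
  shows "sublinear_on V q" and "f \<in> V \<Longrightarrow> q f \<le> p (\<lambda>x. f x + g x) - p g"
    and "f \<in> V \<Longrightarrow> q f \<le> p f"
proof -
  have cl: "(\<lambda>x. f x + t * g x) \<in> V" "(\<lambda>x. t * g x) \<in> V" if "f \<in> V" for f t
    using function_spaceD[OF V] g that by auto
  have bdd: "bdd_below ((\<lambda>t. p (\<lambda>x. f x + t * g x) - t * p g) ` {0..})" if f: "f \<in> V" for f
  proof (rule bdd_belowI2)
    fix t :: real assume "t \<in> {0..}"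
    then have t: "t \<ge> 0" by simp
    have mf: "(\<lambda>x. - f x) \<in> V" by (rule function_spaceD(4)[OF V f])
    have "p (\<lambda>x. (f x + t * g x) + - f x) \<le> p (\<lambda>x. f x + t * g x) + p (\<lambda>x. - f x)"
      by (rule sublinear_onD(1)[OF p cl(1)[OF f] mf])
    moreover have "p (\<lambda>x. (f x + t * g x) + - f x) = t * p g"
      using sublinear_on_scale[OF V p g t] by simp
    ultimately show "- p (\<lambda>x. - f x) \<le> p (\<lambda>x. f x + t * g x) - t * p g" by linarith
  qed
  have q: "q f = (INF t\<in>{0::real..}. p (\<lambda>x. f x + t * g x) - t * p g)" for f
    by (simp add: q_def)
  have low: "q f \<le> p (\<lambda>x. f x + t * g x) - t * p g" if "f \<in> V" "t \<ge> 0" for f t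
    unfolding q using that by (intro cINF_lower[OF bdd]) auto
  show "f \<in> V \<Longrightarrow> q f \<le> p (\<lambda>x. f x + g x) - p g" "f \<in> V \<Longrightarrow> q f \<le> p f"
    using low[of f 1] low[of f 0] by auto
  show "sublinear_on V q"
    unfolding sublinear_on_def
  proof (intro conjI ballI allI impI)
    fix f h assume f: "f \<in> V" and h: "h \<in> V"
    then have fh: "(\<lambda>x. f x + h x) \<in> V" by (intro function_spaceD[OF V] f h)
    have *: "q (\<lambda>x. f x + h x) \<le> (p (\<lambda>x. f x + s * g x) - s * p g) + (p (\<lambda>x. h x + t * g x) - t * p g)"
      if "s \<ge> 0" "t \<ge> 0" for s t
    proof -
      have "q (\<lambda>x. f x + h x) \<le> p (\<lambda>x. (f x + h x) + (s + t) * g x) - (s + t) * p g"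
        using low[OF fh, of "s + t"] that by simp
      also have "(\<lambda>x. (f x + h x) + (s + t) * g x) = (\<lambda>x. (f x + s * g x) + (h x + t * g x))"
        by (simp add: algebra_simps)
      also have "p \<dots> \<le> p (\<lambda>x. f x + s * g x) + p (\<lambda>x. h x + t * g x)"
        by (rule sublinear_onD(1)[OF p cl(1)[OF f] cl(1)[OF h]])
      finally show ?thesis by (simp add: algebra_simps)
    qed
    have "q (\<lambda>x. f x + h x) - (p (\<lambda>x. h x + t * g x) - t * p g) \<le> q f" if "t \<ge> 0" for t
      unfolding q[of f] by (rule cINF_greatest) (use *[of _ t] that in \<open>auto simp: algebra_simps\<close>)
    then have "q (\<lambda>x. f x + h x) - q f \<le> q h"
      unfolding q[of h] by (intro cINF_greatest) (auto simp: algebra_simps)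
    then show "q (\<lambda>x. f x + h x) \<le> q f + q h" by linarith
  next
    fix f and c :: real assume f: "f \<in> V" and c: "c > 0"
    then have cf: "(\<lambda>x. c * f x) \<in> V" by (intro function_spaceD[OF V] f)
    have "q (\<lambda>x. c * f x) / c \<le> q f"
      unfolding q[of f]
    proof (rule cINF_greatest)
      fix t :: real assume "t \<in> {0..}"
      then have t: "t \<ge> 0" by simp
      have "q (\<lambda>x. c * f x) \<le> p (\<lambda>x. c * f x + (c * t) * g x) - (c * t) * p g"
        using low[OF cf, of "c * t"] c t by simp
      also have "(\<lambda>x. c * f x + (c * t) * g x) = (\<lambda>x. c * (f x + t * g x))"
        by (simp add: algebra_simps)
      also have "p \<dots> \<le> c * p (\<lambda>x. f x + t * g x)"
        by (rule sublinear_onD(2)[OF p cl(1)[OF f] c])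
      finally show "q (\<lambda>x. c * f x) / c \<le> p (\<lambda>x. f x + t * g x) - t * p g"
        using c by (simp add: field_simps)
    qed simp
    then show "q (\<lambda>x. c * f x) \<le> c * q f" using c by (simp add: field_simps)
  next
    have "q (\<lambda>_. 0) = (INF t\<in>{0::real..}. 0)"
      unfolding q by (intro INF_cong) (use sublinear_on_scale[OF V p g] in auto)
    then show "q (\<lambda>_. 0) = 0" by simp
  qed
qed

text \<open>
The Hahn--Banach theorem in the form in which no subspace is prescribed: a minimal sublinear
functional is linear.
\<close>

theorem sublinear_dominates_linear:
  assumes V: "function_space V" and P: "sublinear_on V P"
  obtains \<Lambda> where "linear_functional_on V \<Lambda>" "\<And>f. f \<in> V \<Longrightarrow> \<Lambda> f \<le> P f"
proof -
  obtain p where p: "sublinear_on V p" and le: "\<And>f. f \<in> V \<Longrightarrow> p f \<le> P f"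
    and min: "\<And>q. sublinear_on V q \<Longrightarrow> (\<And>f. f \<in> V \<Longrightarrow> q f \<le> p f) \<Longrightarrow> \<forall>f\<in>V. q f = p f"
    using minimal_sublinear_below[OF V P] by blast
  have add: "p (\<lambda>x. f x + g x) = p f + p g" if f: "f \<in> V" and g: "g \<in> V" for f g
  proof (rule antisym)
    show "p (\<lambda>x. f x + g x) \<le> p f + p g" by (rule sublinear_onD(1)[OF p f g])
    note sh = sublinear_on_shift[OF V p g]
    have "(INF t\<in>{0::real..}. p (\<lambda>x. f x + t * g x) - t * p g) = p f"
      using min[OF sh(1) sh(3)] f by blast
    then show "p f + p g \<le> p (\<lambda>x. f x + g x)" using sh(2)[OF f] by linarith
  qed
  have neg: "p (\<lambda>x. - f x) = - p f" if f: "f \<in> V" for f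
  proof -
    have "(\<lambda>x. - f x) \<in> V" by (rule function_spaceD(4)[OF V f])
    from add[OF f this] show ?thesis using sublinear_onD(3)[OF p] by simp
  qed
  have scale: "p (\<lambda>x. c * f x) = c * p f" if f: "f \<in> V" for f c
  proof (cases "c \<ge> 0")
    case True
    then show ?thesis by (rule sublinear_on_scale[OF V p f])
  next
    case False
    then have "p (\<lambda>x. (-c) * f x) = (-c) * p f" by (intro sublinear_on_scale[OF V p f]) simp
    moreover have "(\<lambda>x. (-c) * f x) \<in> V" by (rule function_spaceD(3)[OF V f])
    from neg[OF this] have "p (\<lambda>x. c * f x) = - p (\<lambda>x. (-c) * f x)" by simp
    ultimately show ?thesis by simp
  qed
  show thesis
    by (rule that[of p]) (use add scale le in \<open>auto simp: linear_functional_on_def\<close>)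
qed

section \<open>Positive functionals on functions of polynomial growth\<close>

text \<open>
The space on which positive functionals are considered: it contains the polynomials and the
indicators of half lines, from which a distribution function can be read off.
\<close>

definition poly_bounded :: "(real \<Rightarrow> real) set" where
  "poly_bounded = {f. \<exists>q. \<forall>x. \<bar>f x\<bar> \<le> poly q x}"

lemma poly_boundedI: "(\<And>x. \<bar>f x\<bar> \<le> poly q x) \<Longrightarrow> f \<in> poly_bounded"
  by (auto simp: poly_bounded_def)

lemma poly_bounded_poly [simp]: "poly p \<in> poly_bounded"
proof (rule poly_boundedI)
  fix x
  have "0 \<le> (\<bar>poly p x\<bar> - 1)\<^sup>2 + (poly p x)\<^sup>2 + 1" by simp
  then have "2 * \<bar>poly p x\<bar> \<le> 2 * (1 + poly p x * poly p x)"
    by (simp add: power2_eq_square algebra_simps)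
  then show "\<bar>poly p x\<bar> \<le> poly ([:1:] + p * p) x" by simp
qed

lemma poly_bounded_bounded: "(\<And>x. \<bar>f x\<bar> \<le> C) \<Longrightarrow> f \<in> poly_bounded"
  by (rule poly_boundedI[of _ "[:C:]"]) simp

lemma poly_bounded_indicator [simp]: "indicat_real A \<in> poly_bounded"
  by (rule poly_bounded_bounded[of _ 1]) (simp add: indicator_def)

lemma poly_bounded_mult:
  assumes "f \<in> poly_bounded" "g \<in> poly_bounded"
  shows "(\<lambda>x. f x * g x) \<in> poly_bounded"
proof -
  from assms obtain p q where "\<And>x. \<bar>f x\<bar> \<le> poly p x" "\<And>x. \<bar>g x\<bar> \<le> poly q x"
    by (auto simp: poly_bounded_def)
  then have "\<bar>f x * g x\<bar> \<le> poly (p * q) x" for x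
    unfolding abs_mult poly_mult by (meson abs_ge_zero mult_mono order_trans)
  then show ?thesis by (rule poly_boundedI)
qed

lemma function_space_poly_bounded: "function_space poly_bounded"
  unfolding function_space_def
proof (intro conjI ballI allI)
  show "(\<lambda>_. 0) \<in> poly_bounded" by (rule poly_bounded_bounded[of _ 0]) simp
  fix f assume f: "f \<in> poly_bounded"
  fix c :: real
  show "(\<lambda>x. c * f x) \<in> poly_bounded"
    by (rule poly_bounded_mult[OF poly_bounded_bounded[of _ "\<bar>c\<bar>"] f]) simp
next
  fix f g assume "f \<in> poly_bounded" "g \<in> poly_bounded"
  then obtain p q where "\<And>x. \<bar>f x\<bar> \<le> poly p x" "\<And>x. \<bar>g x\<bar> \<le> poly q x"
    by (auto simp: poly_bounded_def)
  then have "\<bar>f x + g x\<bar> \<le> poly (p + q) x" for x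
    unfolding poly_add by (meson abs_triangle_ineq add_mono order_trans)
  then show "(\<lambda>x. f x + g x) \<in> poly_bounded" by (rule poly_boundedI)
qed

locale positive_functional =
  fixes \<Lambda> :: "(real \<Rightarrow> real) \<Rightarrow> real"
  assumes linear: "linear_functional_on poly_bounded \<Lambda>"
    and pos: "f \<in> poly_bounded \<Longrightarrow> (\<And>x. 0 \<le> f x) \<Longrightarrow> 0 \<le> \<Lambda> f"

text \<open>
The functional \<open>P f = inf {L q | q \<ge> f}\<close> is sublinear, and a linear functional below \<open>P\<close> is
automatically positive (if \<open>f \<ge> 0\<close>, then \<open>0\<close> is a polynomial above \<open>-f\<close>) and agrees with \<open>L\<close> on
polynomials (apply the bound to \<open>q\<close> and \<open>-q\<close>).
\<close>

theorem M_Riesz_extension: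
  fixes L :: "real poly \<Rightarrow> real"
  assumes add: "\<And>p q. L (p + q) = L p + L q"
    and scale: "\<And>c p. L (smult c p) = c * L p"
    and pos: "\<And>p. (\<And>x. 0 \<le> poly p x) \<Longrightarrow> 0 \<le> L p"
  obtains \<Lambda> where "positive_functional \<Lambda>" "\<And>p. \<Lambda> (poly p) = L p"
proof -
  define U where "U = (\<lambda>f::real \<Rightarrow> real. {q. \<forall>x. f x \<le> poly q x})"
  define P where "P = (\<lambda>f. INF q\<in>U f. L q)"
  have neg: "L (- p) = - L p" for p
    using scale[of "-1" p] by simp
  have L0: "L 0 = 0" using scale[of 0 0] by simp
  have bdd: "bdd_below (L ` U f)" and ne: "U f \<noteq> {}" if f: "f \<in> poly_bounded" for f
  proof -
    obtain q where q: "\<And>x. \<bar>f x\<bar> \<le> poly q x" using f by (auto simp: poly_bounded_def)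
    then have "q \<in> U f" unfolding U_def using abs_le_D1 by blast
    then show "U f \<noteq> {}" by blast
    show "bdd_below (L ` U f)"
    proof (rule bdd_belowI2)
      fix r assume r: "r \<in> U f"
      have "0 \<le> poly (r + q) x" for x
      proof -
        have "f x \<le> poly r x" using r by (simp add: U_def)
        then show ?thesis using q[of x] by simp
      qed
      then have "0 \<le> L (r + q)" by (rule pos)
      then show "- L q \<le> L r" by (simp add: add)
    qed
  qed
  have low: "P f \<le> L q" if "f \<in> poly_bounded" "\<And>x. f x \<le> poly q x" for f q
    unfolding P_def using that by (intro cINF_lower[OF bdd]) (auto simp: U_def)
  have great: "c \<le> P f" if "f \<in> poly_bounded" "\<And>q. q \<in> U f \<Longrightarrow> c \<le> L q" for f c
    unfolding P_def by (rule cINF_greatest[OF ne[OF that(1)] that(2)])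
  have sub: "sublinear_on poly_bounded P"
    unfolding sublinear_on_def
  proof (intro conjI ballI allI impI)
    fix f g assume f: "f \<in> poly_bounded" and g: "g \<in> poly_bounded"
    have fg: "(\<lambda>x. f x + g x) \<in> poly_bounded"
      by (rule function_spaceD(2)[OF function_space_poly_bounded f g])
    have *: "P (\<lambda>x. f x + g x) \<le> L q + L r" if "q \<in> U f" "r \<in> U g" for q r
      using low[OF fg, of "q + r"] that add[of q r] by (simp add: U_def add_mono)
    have "P (\<lambda>x. f x + g x) - L r \<le> P f" if "r \<in> U g" for r
      by (rule great[OF f]) (use *[OF _ that] in \<open>simp add: diff_le_eq\<close>)
    then have "P (\<lambda>x. f x + g x) - P f \<le> L r" if "r \<in> U g" for r
      using that by (simp add: algebra_simps)
    then have "P (\<lambda>x. f x + g x) - P f \<le> P g"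
      by (rule great[OF g])
    then show "P (\<lambda>x. f x + g x) \<le> P f + P g" by simp
  next
    fix f and c :: real assume f: "f \<in> poly_bounded" and c: "c > 0"
    have cf: "(\<lambda>x. c * f x) \<in> poly_bounded"
      by (rule function_spaceD(3)[OF function_space_poly_bounded f])
    have "P (\<lambda>x. c * f x) / c \<le> L q" if "q \<in> U f" for q
      using low[OF cf, of "smult c q"] that scale[of c q] c by (simp add: U_def field_simps)
    then have "P (\<lambda>x. c * f x) / c \<le> P f"
      by (rule great[OF f])
    then show "P (\<lambda>x. c * f x) \<le> c * P f" using c by (simp add: field_simps)
  next
    have z: "(\<lambda>_. 0) \<in> poly_bounded" by (rule function_spaceD(1)[OF function_space_poly_bounded])
    have "P (\<lambda>_. 0) \<le> 0" using low[OF z, of 0] L0 by simp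
    moreover have "0 \<le> P (\<lambda>_. 0)"
      by (rule great[OF z]) (auto intro: pos simp: U_def)
    ultimately show "P (\<lambda>_. 0) = 0" by simp
  qed
  obtain \<Lambda> where lin: "linear_functional_on poly_bounded \<Lambda>"
    and le: "\<And>f. f \<in> poly_bounded \<Longrightarrow> \<Lambda> f \<le> P f"
    using sublinear_dominates_linear[OF function_space_poly_bounded sub] by blast
  have mult: "\<Lambda> (\<lambda>x. c * f x) = c * \<Lambda> f" if "f \<in> poly_bounded" for f c
    using lin[unfolded linear_functional_on_def, THEN conjunct2, THEN bspec, OF that] by blast
  show thesis
  proof (rule that[of \<Lambda>])
    show "positive_functional \<Lambda>"
    proof
      show "linear_functional_on poly_bounded \<Lambda>" by (rule lin)
      fix f assume f: "f \<in> poly_bounded" and nn: "\<And>x. (0::real) \<le> f x"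
      have mf: "(\<lambda>x. -1 * f x) \<in> poly_bounded"
        by (rule function_spaceD(3)[OF function_space_poly_bounded f])
      have "- \<Lambda> f = \<Lambda> (\<lambda>x. -1 * f x)" using mult[OF f, of "-1"] by linarith
      also have "\<dots> \<le> P (\<lambda>x. -1 * f x)" by (rule le[OF mf])
      also have "\<dots> \<le> L 0" by (rule low[OF mf]) (use nn in simp)
      finally show "0 \<le> \<Lambda> f" using L0 by simp
    qed
    fix p :: "real poly"
    have up: "\<Lambda> (poly q) \<le> L q" for q
      using le[of "poly q"] low[of "poly q" q] by simp
    have "poly (- p) = (\<lambda>x. -1 * poly p x)" by (rule ext) simp
    then have "- \<Lambda> (poly p) = \<Lambda> (poly (- p))" using mult[of "poly p" "-1"] by simp
    then show "\<Lambda> (poly p) = L p" using up[of p] up[of "- p"] neg[of p] by linarith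
  qed
qed

context positive_functional
begin

lemma add: "f \<in> poly_bounded \<Longrightarrow> g \<in> poly_bounded \<Longrightarrow> \<Lambda> (\<lambda>x. f x + g x) = \<Lambda> f + \<Lambda> g"
  using linear[unfolded linear_functional_on_def, THEN conjunct1, THEN bspec, of f, THEN bspec, of g] .

lemma scale: "f \<in> poly_bounded \<Longrightarrow> \<Lambda> (\<lambda>x. c * f x) = c * \<Lambda> f"
  using linear[unfolded linear_functional_on_def, THEN conjunct2, THEN bspec, of f, THEN spec, of c] .

lemma diff:
  assumes f: "f \<in> poly_bounded" and g: "g \<in> poly_bounded"
  shows "\<Lambda> (\<lambda>x. f x - g x) = \<Lambda> f - \<Lambda> g"
  using add[OF f function_spaceD(3)[OF function_space_poly_bounded g, of "-1"]] scale[OF g, of "-1"]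
  by simp

lemma poly_bounded_diff:
  assumes f: "f \<in> poly_bounded" and g: "g \<in> poly_bounded"
  shows "(\<lambda>x. f x - g x) \<in> poly_bounded"
  using function_spaceD(2)[OF function_space_poly_bounded f function_spaceD(4)[OF function_space_poly_bounded g]]
  by simp

lemma functional_mono:
  assumes f: "f \<in> poly_bounded" and g: "g \<in> poly_bounded" and le: "\<And>x. f x \<le> g x"
  shows "\<Lambda> f \<le> \<Lambda> g"
  using pos[OF poly_bounded_diff[OF g f]] le diff[OF g f] by simp

definition cdf_fun :: "real \<Rightarrow> real" where
  "cdf_fun x = \<Lambda> (indicat_real {..x})"

text \<open>
The functional is only finitely additive, so \<open>cdf_fun\<close> need not be right continuous; its right
limits define the Stieltjes measure that represents the functional on polynomials.
\<close>

definition cdf_right :: "real \<Rightarrow> real" where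
  "cdf_right x = (INF y\<in>{x<..}. cdf_fun y)"

lemma cdf_fun_mono: "x \<le> y \<Longrightarrow> cdf_fun x \<le> cdf_fun y"
  unfolding cdf_fun_def by (rule functional_mono) (auto simp: indicator_def)

lemma cdf_fun_nonneg: "0 \<le> cdf_fun x"
  unfolding cdf_fun_def by (rule pos) auto

lemma Ioc: "x \<le> y \<Longrightarrow> \<Lambda> (indicat_real {x<..y}) = cdf_fun y - cdf_fun x"
proof -
  assume xy: "x \<le> y"
  have "indicat_real {x<..y} = (\<lambda>t. indicat_real {..y} t - indicat_real {..x} t)"
    using xy by (auto simp: indicator_def fun_eq_iff)
  then show ?thesis by (simp add: diff cdf_fun_def)
qed

lemma cdf_bdd: "bdd_below (cdf_fun ` A)"
  by (rule bdd_belowI2[of _ 0]) (rule cdf_fun_nonneg)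

lemma cdf_right_le: "x < y \<Longrightarrow> cdf_right x \<le> cdf_fun y"
  unfolding cdf_right_def by (rule cINF_lower[OF cdf_bdd]) simp

lemma cdf_right_ge: "cdf_fun x \<le> cdf_right x"
  unfolding cdf_right_def by (rule cINF_greatest) (auto intro: cdf_fun_mono)

lemma cdf_right_mono: "x \<le> y \<Longrightarrow> cdf_right x \<le> cdf_right y"
  by (cases "x = y") (auto intro: order_trans[OF cdf_right_le cdf_right_ge])

lemma cdf_right_continuous: "continuous (at_right a) cdf_right"
  unfolding continuous_within
proof (rule order_tendstoI)
  fix l assume "l < cdf_right a"
  then show "\<forall>\<^sub>F x in at_right a. l < cdf_right x"
    using cdf_right_mono by (intro eventually_at_right_less[THEN eventually_mono]) (meson less_imp_le less_le_trans)
next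
  fix u assume "cdf_right a < u"
  then obtain y where y: "y > a" "cdf_fun y < u"
    unfolding cdf_right_def using cINF_less_iff[OF _ cdf_bdd, of "{a<..}"] by auto
  have "\<forall>\<^sub>F x in at_right a. x < y" using y(1) unfolding eventually_at_right_field by (intro exI[of _ y]) simp
  then show "\<forall>\<^sub>F x in at_right a. cdf_right x < u"
    by (rule eventually_mono) (use cdf_right_le y(2) in \<open>meson le_less_trans\<close>)
qed

abbreviation rep_measure :: "real measure" where
  "rep_measure \<equiv> interval_measure cdf_right"

lemma borel_measurable_poly [measurable]: "poly (p :: real poly) \<in> borel_measurable rep_measure"
  unfolding measurable_cong_sets[OF sets_interval_measure refl]
  by (intro borel_measurable_continuous_onI continuous_intros)

lemma emeasure_Ioc: "x \<le> y \<Longrightarrow> emeasure rep_measure {x<..y} = ennreal (cdf_right y - cdf_right x)"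
  by (rule emeasure_interval_measure_Ioc[OF _ cdf_right_mono cdf_right_continuous])

lemma countable_discontinuities: "countable {x. cdf_right x \<noteq> cdf_fun x}"
proof (rule countable_subset)
  show "countable {x. \<not> isCont cdf_fun x}"
    by (rule mono_ctble_discont) (simp add: cdf_fun_mono monoI)
  have "cdf_right x \<le> cdf_fun x" if "isCont cdf_fun x" for x
  proof (rule tendsto_lowerbound)
    show "(cdf_fun \<longlongrightarrow> cdf_fun x) (at_right x)"
      using that unfolding isCont_def by (rule filterlim_mono) (auto intro: at_le)
    show "\<forall>\<^sub>F y in at_right x. cdf_right x \<le> cdf_fun y"
      by (rule eventually_mono[OF eventually_at_right_less]) (rule cdf_right_le)
  qed simp
  then show "{x. cdf_right x \<noteq> cdf_fun x} \<subseteq> {x. \<not> isCont cdf_fun x}"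
    using cdf_right_ge by (auto intro: antisym)
qed

text \<open>
Integrability is known at this stage only on bounded intervals; that the whole measure is finite
comes out of the convergence of truncated integrals.
\<close>

lemma integrable_Ioc: "integrable rep_measure (\<lambda>t. poly p t * indicat_real {x<..y} t)"
proof -
  have "bounded (poly p ` {x..y})"
    by (intro compact_imp_bounded compact_continuous_image continuous_intros) auto
  then obtain B where B: "\<forall>t\<in>{x..y}. \<bar>poly p t\<bar> \<le> B"
    unfolding bounded_iff by auto
  have fin: "emeasure rep_measure {x<..y} < \<infinity>"
    by (cases "x \<le> y") (auto simp: emeasure_Ioc)
  show ?thesis
    by (rule integrableI_bounded_set_indicator[where A = "{x<..y}" and B = B, 
          of rep_measure "poly p", simplified mult.commute real_scaleR_def])
      (use fin B in auto)
qed

lemma poly_Ioc_bounded: "(\<lambda>t. poly p t * indicat_real {x<..y} t) \<in> poly_bounded"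
  by (rule poly_bounded_mult) auto

text \<open>
The error of the representation on \<open>{x<..y}\<close>.  It is subadditive over adjacent intervals and of
the order of the oscillation of \<open>p\<close> times the mass, so that refining a partition makes it vanish.
\<close>

definition gap :: "real poly \<Rightarrow> real \<Rightarrow> real \<Rightarrow> real" where
  "gap p x y = \<bar>\<Lambda> (\<lambda>t. poly p t * indicat_real {x<..y} t)
     - (\<integral>t. poly p t * indicat_real {x<..y} t \<partial>rep_measure)\<bar>"

lemma gap_add:
  assumes "x \<le> y" "y \<le> z"
  shows "gap p x z \<le> gap p x y + gap p y z"
proof -
  have eq: "(\<lambda>t. poly p t * indicat_real {x<..z} t) =
      (\<lambda>t. poly p t * indicat_real {x<..y} t + poly p t * indicat_real {y<..z} t)"
    using assms by (auto simp: indicator_def fun_eq_iff)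
  show ?thesis
    unfolding gap_def eq using integrable_Ioc[of p]
    by (simp add: add[OF poly_Ioc_bounded poly_Ioc_bounded])
qed

text \<open>
At points where \<open>cdf_right\<close> and \<open>cdf_fun\<close> agree, the functional and the measure give the
same value to the indicator of the interval, and \<open>p\<close> differs from a constant by at most \<open>e\<close>.
\<close>

lemma gap_cell:
  assumes xy: "x \<le> y" and good: "cdf_right x = cdf_fun x" "cdf_right y = cdf_fun y"
    and e: "\<And>t. t \<in> {x<..y} \<Longrightarrow> \<bar>poly p t - c\<bar> \<le> e"
  shows "gap p x y \<le> 2 * e * (cdf_right y - cdf_right x)"
proof -
  define J where "J = indicat_real {x<..y}"
  define m where "m = cdf_right y - cdf_right x"
  have J: "J \<in> poly_bounded" by (simp add: J_def)
  have LJ: "\<Lambda> J = m" using Ioc[OF xy] good by (simp add: J_def m_def)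
  have I: "integrable rep_measure J"
    using integrable_Ioc[of 1 x y] by (simp add: J_def)
  have IJ: "(\<integral>t. J t \<partial>rep_measure) = m"
    using xy cdf_right_mono[OF xy] by (simp add: J_def m_def measure_def emeasure_Ioc)
  have pJ: "(\<lambda>t. poly p t * J t) \<in> poly_bounded" and pI: "integrable rep_measure (\<lambda>t. poly p t * J t)"
    using poly_Ioc_bounded integrable_Ioc by (auto simp: J_def)
  have sc: "(\<lambda>t. d * J t) \<in> poly_bounded" for d
    by (rule function_spaceD(3)[OF function_space_poly_bounded J])
  have up: "poly p t * J t \<le> (c + e) * J t" and lo: "(c - e) * J t \<le> poly p t * J t" for t
    using e[of t] by (auto simp: J_def indicator_def abs_le_iff)
  have "\<Lambda> (\<lambda>t. poly p t * J t) \<le> (c + e) * m"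
    using functional_mono[OF pJ sc up] scale[OF J, of "c + e"] LJ by simp
  moreover have "(c - e) * m \<le> \<Lambda> (\<lambda>t. poly p t * J t)"
    using functional_mono[OF sc pJ lo] scale[OF J, of "c - e"] LJ by simp
  moreover have "(\<integral>t. poly p t * J t \<partial>rep_measure) \<le> (\<integral>t. (c + e) * J t \<partial>rep_measure)"
    by (rule integral_mono[OF pI _ up]) (use I in simp)
  moreover have "(\<integral>t. (c - e) * J t \<partial>rep_measure) \<le> (\<integral>t. poly p t * J t \<partial>rep_measure)"
    by (rule integral_mono[OF _ pI lo]) (use I in simp)
  ultimately have "\<Lambda> (\<lambda>t. poly p t * J t) \<le> (c + e) * m" "(c - e) * m \<le> \<Lambda> (\<lambda>t. poly p t * J t)"
    "(\<integral>t. poly p t * J t \<partial>rep_measure) \<le> (c + e) * m" "(c - e) * m \<le> (\<integral>t. poly p t * J t \<partial>rep_measure)"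
    using IJ by simp_all
  then show ?thesis
    unfolding gap_def J_def[symmetric] m_def[symmetric] ring_distribs abs_le_iff by linarith
qed

lemma gap_cells:
  assumes h: "h \<ge> 0" and good: "\<And>k. k \<le> n \<Longrightarrow> cdf_right (x + real k * h) = cdf_fun (x + real k * h)"
    and e: "\<And>k t. k < n \<Longrightarrow> t \<in> {x + real k * h<..x + real (Suc k) * h} \<Longrightarrow>
      \<bar>poly p t - poly p (x + real k * h)\<bar> \<le> e"
  shows "gap p x (x + real n * h) \<le> 2 * e * (cdf_right (x + real n * h) - cdf_right x)"
  using good e
proof (induction n)
  case 0
  then show ?case by (simp add: gap_def) (use scale[of "\<lambda>_. 0" 0] poly_bounded_bounded[of "\<lambda>_. 0" 0] in simp)
next
  case (Suc n)
  let ?y = "x + real n * h" and ?z = "x + real (Suc n) * h"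
  have "x \<le> ?y" "?y \<le> ?z" using h by (auto simp: algebra_simps)
  then have "gap p x ?z \<le> gap p x ?y + gap p ?y ?z" by (rule gap_add)
  also have "gap p x ?y \<le> 2 * e * (cdf_right ?y - cdf_right x)"
    using Suc.prems by (intro Suc.IH) auto
  also have "gap p ?y ?z \<le> 2 * e * (cdf_right ?z - cdf_right ?y)"
    using Suc.prems(1)[of n] Suc.prems(1)[of "Suc n"] Suc.prems(2)[of n] \<open>?y \<le> ?z\<close>
    by (intro gap_cell) (auto simp del: of_nat_Suc)
  finally show ?case by (simp add: algebra_simps)
qed

text \<open>
The exceptional points are countable, hence so are their translates by rational numbers; some
origin \<open>a\<close> avoids all of them, and then every rational grid based at \<open>a\<close> is admissible.
\<close>

lemma common_grid:
  obtains a where "\<And>k m. cdf_right (a + real_of_int k / real (Suc m)) = cdf_fun (a + real_of_int k / real (Suc m))"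
proof -
  define B where "B = {x. cdf_right x \<noteq> cdf_fun x}"
  have "countable (\<Union>k m. (\<lambda>x. x - real_of_int k / real (Suc m)) ` B)"
    using countable_discontinuities by (auto simp: B_def)
  then obtain a where a: "a \<notin> (\<Union>k m. (\<lambda>x. x - real_of_int k / real (Suc m)) ` B)"
    using uncountable_UNIV_real by (metis UNIV_eq_I)
  have "a + real_of_int k / real (Suc m) \<notin> B" for k m
  proof
    assume "a + real_of_int k / real (Suc m) \<in> B"
    then have "(a + real_of_int k / real (Suc m)) - real_of_int k / real (Suc m)
        \<in> (\<lambda>x. x - real_of_int k / real (Suc m)) ` B" by (rule imageI)
    then show False using a by simp
  qed
  then show thesis by (intro that[of a]) (simp add: B_def del: of_nat_Suc)
qed

lemma truncated_integral:
  assumes a: "\<And>k m. cdf_right (a + real_of_int k / real (Suc m)) = cdf_fun (a + real_of_int k / real (Suc m))"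
  shows "\<Lambda> (\<lambda>t. poly p t * indicat_real {a - real N<..a + real N} t)
    = (\<integral>t. poly p t * indicat_real {a - real N<..a + real N} t \<partial>rep_measure)"
proof -
  define M where "M = cdf_right (a + real N) - cdf_right (a - real N)"
  have M: "M \<ge> 0" using cdf_right_mono[of "a - real N" "a + real N"] by (simp add: M_def)
  have "gap p (a - real N) (a + real N) \<le> 0 + e" if "e > 0" for e
  proof -
    define e' where "e' = e / (2 * (M + 1))"
    have e': "e' > 0" using that M by (simp add: e'_def)
    have "uniformly_continuous_on {a - real N..a + real N} (poly p)"
      by (intro compact_uniformly_continuous continuous_intros) auto
    then obtain d where d: "d > 0" "\<And>s t. s \<in> {a - real N..a + real N} \<Longrightarrow> t \<in> {a - real N..a + real N}
        \<Longrightarrow> dist s t < d \<Longrightarrow> dist (poly p s) (poly p t) < e'"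
      unfolding uniformly_continuous_on_def using e' by metis
    obtain m where m: "1 / real (Suc m) < d" using d(1) nat_approx_posE by blast
    \<comment> \<open>The nodes \<open>a - N + k h\<close> belong to the grid of mesh \<open>h\<close> based at \<open>a\<close>, and \<open>n\<close> cells fill the interval.\<close>
    define h where "h = 1 / real (Suc m)"
    define n where "n = 2 * N * Suc m"
    have h: "h > 0" by (simp add: h_def)
    have hm: "real (Suc m) * h = 1" unfolding h_def by (simp del: of_nat_Suc)
    have "real n * h = 2 * real N * (real (Suc m) * h)"
      by (simp only: n_def of_nat_mult mult.assoc of_nat_numeral)
    then have nh: "real n * h = 2 * real N" unfolding hm by simp
    have node: "a - real N + real k * h = a + real_of_int (int k - int (N * Suc m)) / real (Suc m)" for k
      unfolding h_def by (simp add: field_simps)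
    have "gap p (a - real N) (a - real N + real n * h) \<le>
        2 * e' * (cdf_right (a - real N + real n * h) - cdf_right (a - real N))"
    proof (rule gap_cells)
      show "cdf_right (a - real N + real k * h) = cdf_fun (a - real N + real k * h)" for k
        unfolding node by (rule a)
      fix k t assume k: "k < n" and t: "t \<in> {a - real N + real k * h<..a - real N + real (Suc k) * h}"
      have "real (Suc k) * h \<le> real n * h" using k h by (intro mult_right_mono) auto
      then have "real (Suc k) * h \<le> 2 * real N" using nh by simp
      moreover have "real (Suc k) * h = real k * h + h" "0 \<le> real k * h" using h by (auto simp: algebra_simps)
      ultimately have rng: "a - real N \<le> t" "t \<le> a + real N" "a - real N + real k * h \<le> a + real N"
        "0 \<le> real k * h" "\<bar>t - (a - real N + real k * h)\<bar> < d"
        using t m[folded h_def] h by (simp_all only: greaterThanAtMost_iff abs_less_iff) linarith+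
      then have "dist (poly p t) (poly p (a - real N + real k * h)) < e'"
        by (intro d(2)) (auto simp: dist_real_def)
      then show "\<bar>poly p t - poly p (a - real N + real k * h)\<bar> \<le> e'" by (simp add: dist_real_def)
    qed (use h in simp)
    moreover have "a - real N + real n * h = a + real N" using nh by simp
    ultimately have "gap p (a - real N) (a + real N) \<le> 2 * e' * M" by (simp add: M_def)
    also have "\<dots> \<le> e" using that M by (simp add: e'_def field_simps)
    finally show ?thesis by simp
  qed
  then have "gap p (a - real N) (a + real N) \<le> 0" by (rule field_le_epsilon)
  then show ?thesis by (simp add: gap_def)
qed

text \<open>
Outside \<open>{a - N<..a + N}\<close> the factor \<open>((t - a) / N)\<^sup>2\<close> is at least \<open>1\<close>, so the truncated part is
dominated by the polynomial \<open>p (t - a)\<^sup>2 / N\<^sup>2\<close>, whose value under the functional tends to \<open>0\<close>.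
\<close>

lemma truncation_tendsto:
  assumes p: "\<And>x. 0 \<le> poly p x"
  shows "(\<lambda>N. \<Lambda> (\<lambda>t. poly p t * indicat_real {a - real N<..a + real N} t)) \<longlonglongrightarrow> \<Lambda> (poly p)"
proof -
  define J where "J = (\<lambda>N::nat. indicat_real {a - real N<..a + real N})"
  \<comment> \<open>The tail of \<open>p\<close> is compared with \<open>p(t) (t - a)\<^sup>2 / N\<^sup>2\<close>.\<close>
  define q where "q = p * [:-a, 1:]^2"
  have bound: "\<bar>\<Lambda> (\<lambda>t. poly p t * J N t) - \<Lambda> (poly p)\<bar> \<le> \<Lambda> (poly q) * (1 / real N) ^ 2" if N: "N > 0" for N
  proof -
    have pJ: "(\<lambda>t. poly p t * J N t) \<in> poly_bounded" by (simp add: J_def poly_Ioc_bounded)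
    have 1: "\<Lambda> (\<lambda>t. poly p t * J N t) \<le> \<Lambda> (poly p)"
      by (rule functional_mono[OF pJ]) (use p in \<open>auto simp: J_def indicator_def\<close>)
    have "poly p t - poly p t * J N t \<le> (1 / real N)^2 * poly q t" for t
    proof (cases "t \<in> {a - real N<..a + real N}")
      case True
      then show ?thesis using p[of t] by (simp add: J_def q_def)
    next
      case False
      then have "real N \<le> \<bar>t - a\<bar>" by auto
      then have "1 \<le> (1 / real N)^2 * (t - a)^2"
        using N by (simp add: power_mult_distrib[symmetric] abs_le_square_iff field_simps)
          (metis abs_le_square_iff abs_of_nat)
      then have "poly p t * 1 \<le> poly p t * ((1 / real N)^2 * (t - a)^2)"
        using p[of t] by (intro mult_left_mono)
      then show ?thesis using False by (simp add: J_def q_def algebra_simps)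
    qed
    then have "\<Lambda> (\<lambda>t. poly p t - poly p t * J N t) \<le> \<Lambda> (\<lambda>t. (1 / real N)^2 * poly q t)"
      by (intro functional_mono poly_bounded_diff[OF poly_bounded_poly pJ]
          function_spaceD(3)[OF function_space_poly_bounded]) auto
    then show ?thesis using 1 unfolding diff[OF poly_bounded_poly pJ] scale[OF poly_bounded_poly]
      by (simp add: mult.commute[of "\<Lambda> (poly q)"])
  qed
  have lim: "(\<lambda>N. \<Lambda> (poly q) * (1 / real N)^2) \<longlonglongrightarrow> \<Lambda> (poly q) * 0^2"
    by (intro tendsto_intros lim_1_over_n)
  have "(\<lambda>N. \<Lambda> (\<lambda>t. poly p t * J N t) - \<Lambda> (poly p)) \<longlonglongrightarrow> 0"
  proof (rule Lim_null_comparison[rotated])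
    show "(\<lambda>N. \<Lambda> (poly q) * (1 / real N)^2) \<longlonglongrightarrow> 0" using lim by simp
    show "\<forall>\<^sub>F N in sequentially. norm (\<Lambda> (\<lambda>t. poly p t * J N t) - \<Lambda> (poly p)) \<le> \<Lambda> (poly q) * (1 / real N)^2"
      unfolding real_norm_def by (rule eventually_mono[OF eventually_gt_at_top[of 0] bound])
  qed
  then show ?thesis by (simp add: LIM_zero_iff J_def)
qed

lemma representation_nonneg:
  assumes p: "\<And>x. 0 \<le> poly p x"
  shows "integrable rep_measure (poly p)" and "integral\<^sup>L rep_measure (poly p) = \<Lambda> (poly p)"
proof -
  obtain a where a: "\<And>k m. cdf_right (a + real_of_int k / real (Suc m)) = cdf_fun (a + real_of_int k / real (Suc m))"
    using common_grid by blast
  define f where "f = (\<lambda>(N::nat) t. poly p t * indicat_real {a - real N<..a + real N} t)"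
  have 1: "integrable rep_measure (f N)" for N unfolding f_def by (rule integrable_Ioc)
  have 2: "mono (\<lambda>N. f N t)" for t
    by (rule monoI) (use p[of t] in \<open>auto simp: f_def indicator_def\<close>)
  have 3: "(\<lambda>N. f N t) \<longlonglongrightarrow> poly p t" for t
  proof (rule tendsto_eventually)
    obtain N0 :: nat where "real N0 > \<bar>t - a\<bar>" using reals_Archimedean2 by blast
    then have "f N t = poly p t" if "N \<ge> N0" for N using that by (auto simp: f_def indicator_def)
    then show "\<forall>\<^sub>F N in sequentially. f N t = poly p t" by (rule eventually_sequentiallyI)
  qed
  have 4: "(\<lambda>N. integral\<^sup>L rep_measure (f N)) \<longlonglongrightarrow> \<Lambda> (poly p)"
    using truncation_tendsto[OF p, of a] unfolding truncated_integral[OF a] f_def .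
  have 5: "poly p \<in> borel_measurable rep_measure"
    by (rule borel_measurable_poly)
  show "integrable rep_measure (poly p)" "integral\<^sup>L rep_measure (poly p) = \<Lambda> (poly p)"
    using integrable_monotone_convergence[OF 1 _ _ 4 5] integral_monotone_convergence[OF 1 _ _ 4 5] 2 3 by auto
qed

text \<open>
Every polynomial is the difference of the nonnegative polynomials \<open>1 + p\<^sup>2 + p\<close> and \<open>1 + p\<^sup>2\<close>.
\<close>

lemma representation:
  shows "integrable rep_measure (poly p)" and "integral\<^sup>L rep_measure (poly p) = \<Lambda> (poly p)"
proof -
  define q where "q = 1 + p * p"
  have q: "0 \<le> poly q x" for x by (simp add: q_def)
  have qp: "0 \<le> poly (q + p) x" for x
  proof -
    have "0 \<le> (2 * poly p x + 1)\<^sup>2 + 3" by simp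
    then show ?thesis by (simp add: q_def power2_eq_square algebra_simps)
  qed
  have eq: "poly p = (\<lambda>x. poly (q + p) x - poly q x)" by auto
  note r = representation_nonneg[of q, OF q] representation_nonneg[of "q + p", OF qp]
  show "integrable rep_measure (poly p)"
    unfolding eq by (intro Bochner_Integration.integrable_diff r)
  show "integral\<^sup>L rep_measure (poly p) = \<Lambda> (poly p)"
    unfolding eq Bochner_Integration.integral_diff[OF r(3,1)] r(2,4)
    by (subst diff) simp_all
qed

text \<open>
The representation on polynomials does not see the functional on indicators, but an atom of the
functional does force a jump of the distribution function.
\<close>

lemma rep_measure_singleton: "\<Lambda> (indicat_real {x}) \<le> measure rep_measure {x}"
proof -
  interpret finite_measure rep_measure
  proof
    have "emeasure rep_measure UNIV = \<integral>\<^sup>+x. ennreal (poly 1 x) \<partial>rep_measure" by simp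
    also have "\<dots> < \<infinity>" using representation(1)[of 1] unfolding integrable_iff_bounded by simp
    finally show "emeasure rep_measure (space rep_measure) \<noteq> \<infinity>" by simp
  qed
  define A where "A = (\<lambda>n. {x - 1 / real (Suc n)<..x})"
  have "{x} = (\<Inter>n. A n)"
  proof
    show "(\<Inter>n. A n) \<subseteq> {x}"
    proof
      fix t assume t: "t \<in> (\<Inter>n. A n)"
      have "t = x"
      proof (rule ccontr)
        assume "t \<noteq> x"
        moreover have "t \<le> x" using t by (auto simp: A_def)
        ultimately obtain n where "1 / real (Suc n) < x - t" using nat_approx_posE[of "x - t"] by auto
        moreover have "t \<in> A n" using t by blast
        ultimately show False by (simp add: A_def)
      qed
      then show "t \<in> {x}" by simp
    qed
  qed (auto simp: A_def)
  moreover have "decseq A"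
    unfolding decseq_def A_def by (auto simp: frac_le elim!: less_le_trans[rotated] le_less_trans[rotated])
  ultimately have lim: "(\<lambda>n. measure rep_measure (A n)) \<longlonglongrightarrow> measure rep_measure {x}"
    using finite_Lim_measure_decseq[of A] by (simp add: A_def image_subset_iff)
  have "\<Lambda> (indicat_real {x}) \<le> measure rep_measure (A n)" for n
  proof -
    \<comment> \<open>The point \<open>w\<close> strictly between \<open>y\<close> and \<open>x\<close> absorbs the possible jump of \<open>cdf_fun\<close> at \<open>y\<close>.\<close>
    define y w where "y = x - 1 / real (Suc n)" and "w = x - 1 / (2 * real (Suc n))"
    have yw: "y < w" "w < x" by (auto simp: y_def w_def field_simps)
    have "\<Lambda> (indicat_real {x}) \<le> \<Lambda> (indicat_real {w<..x})"
      by (rule functional_mono) (use yw in \<open>auto simp: indicator_def\<close>)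
    also have "\<dots> = cdf_fun x - cdf_fun w" using yw by (simp add: Ioc)
    also have "\<dots> \<le> cdf_right x - cdf_right y"
      using cdf_right_ge[of x] cdf_right_le[OF yw(1)] by simp
    also have "\<dots> = measure rep_measure (A n)"
      using yw cdf_right_mono[of y x] unfolding A_def y_def[symmetric] measure_def by (simp add: emeasure_Ioc)
    finally show ?thesis .
  qed
  then show ?thesis by (intro LIMSEQ_le_const[OF lim]) auto
qed

end

section \<open>Nonnegative polynomials as squared moduli\<close>

abbreviation cpoly :: "real poly \<Rightarrow> complex \<Rightarrow> complex" where
  "cpoly p \<equiv> poly (map_poly complex_of_real p)"

lemma cpoly_add: "cpoly (p + q) z = cpoly p z + cpoly q z"
proof -
  have "map_poly complex_of_real (p + q) = map_poly complex_of_real p + map_poly complex_of_real q"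
    by (rule poly_eqI) (simp add: coeff_map_poly)
  then show ?thesis by simp
qed

lemma cpoly_smult: "cpoly (smult c p) z = complex_of_real c * cpoly p z"
proof -
  have "map_poly complex_of_real (smult c p) = smult (complex_of_real c) (map_poly complex_of_real p)"
    by (rule poly_eqI) (simp add: coeff_map_poly)
  then show ?thesis by simp
qed

lemma cpoly_mult: "cpoly (p * q) z = cpoly p z * cpoly q z"
  by (induction p) (simp_all add: cpoly_add cpoly_smult map_poly_pCons algebra_simps)

lemma cpoly_of_real: "cpoly p (complex_of_real t) = complex_of_real (poly p t)"
  by (induction p) (simp_all add: map_poly_pCons)

text \<open>
After one linear factor is removed, the quotient is nonnegative to the right of \<open>r\<close> and nonpositive
to its left, so it vanishes at \<open>r\<close> as well.
\<close>

lemma nonneg_poly_even_root: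
  fixes q :: "real poly"
  assumes nn: "\<And>t. 0 \<le> poly q t" and r: "poly q r = 0"
  obtains q' where "q = [:- r, 1:]\<^sup>2 * q'"
proof -
  obtain q1 where q1: "q = [:- r, 1:] * q1"
    using r by (auto simp: poly_eq_0_iff_dvd)
  have lim: "(poly q1 \<longlongrightarrow> poly q1 r) (at r within S)" for S
    by (rule tendsto_within_subset[OF isContD]) (auto intro: poly_isCont)
  have sign: "0 \<le> (t - r) * poly q1 t" for t
    using nn[of t] by (simp add: q1 algebra_simps)
  have "0 \<le> poly q1 t" if "r < t" for t
    using sign[of t] that by (simp add: zero_le_mult_iff)
  then have "0 \<le> poly q1 r"
    by (intro tendsto_lowerbound[OF lim eventually_mono[OF eventually_at_right_less]]) auto
  moreover have "poly q1 t \<le> 0" if "t < r" for t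
    using sign[of t] that by (simp add: zero_le_mult_iff)
  then have "poly q1 r \<le> 0"
    by (intro tendsto_upperbound[OF lim eventually_mono[OF eventually_at_left_real[of "r - 1" r]]]) auto
  ultimately have "poly q1 r = 0" by simp
  then obtain q2 where "q1 = [:- r, 1:] * q2"
    by (auto simp: poly_eq_0_iff_dvd)
  then show thesis using q1 by (intro that[of q2]) (simp only: power2_eq_square mult.assoc)
qed

lemma norm_shift_up:
  assumes "Im r \<le> 0" "y \<ge> 0"
  shows "cmod (complex_of_real x - r) \<le> cmod (complex_of_real x + \<i> * complex_of_real y - r)"
proof -
  have "(Im r)\<^sup>2 \<le> (y - Im r)\<^sup>2"
    using assms by (intro abs_le_square_iff[THEN iffD1]) auto
  then show ?thesis
    unfolding cmod_def by (intro real_sqrt_le_mono) simp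
qed

text \<open>
The remainder of \<open>q\<close> modulo the quadratic \<open>(t - r)(t - cnj r)\<close> has degree at most one, real
coefficients and the nonreal root \<open>r\<close>, so it is \<open>0\<close>.
\<close>

lemma conj_root_quadratic:
  fixes q :: "real poly"
  assumes root: "cpoly q r = 0" and nr: "Im r \<noteq> 0"
  obtains q' where "q = [:(cmod r)\<^sup>2, - 2 * Re r, 1:] * q'"
proof -
  let ?d = "[:(cmod r)\<^sup>2, - 2 * Re r, 1:]"
  define m where "m = q mod ?d"
  have qm: "q = ?d * (q div ?d) + m" unfolding m_def by (rule mult_div_mod_eq[symmetric])
  have dr: "cpoly ?d r = 0"
    by (simp add: map_poly_pCons complex_eq_iff cmod_power2 algebra_simps) (simp add: power2_eq_square)
  have "cpoly q r = cpoly ?d r * cpoly (q div ?d) r + cpoly m r"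
    by (subst qm) (simp only: cpoly_add cpoly_mult)
  then have mr: "cpoly m r = 0" using root dr by simp
  have "m = 0"
  proof -
    have "m = 0 \<or> degree m < degree ?d" unfolding m_def by (rule degree_mod_less) simp
    then have "degree m < 2" by auto
    moreover obtain a m' where m': "m = pCons a m'" by (rule pCons_cases)
    ultimately have "degree m' = 0" by (simp split: if_splits)
    then obtain b where "m' = [:b:]" by (rule degree_eq_zeroE)
    then have m: "m = [:a, b:]" by (simp add: m')
    show ?thesis using mr nr by (auto simp: m map_poly_pCons complex_eq_iff)
  qed
  then show thesis using qm that by simp
qed

text \<open>
Induction on the degree: a real root occurs twice, a nonreal root together with its conjugate; in
either case \<open>s\<close> receives one linear factor, with the root taken in the closed lower half plane.
The second property records what the position of the zeros yields.
\<close>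

theorem nonneg_poly_factorization:
  fixes q :: "real poly"
  assumes "\<And>t. 0 \<le> poly q t"
  shows "\<exists>s :: complex poly. (\<forall>t. (cmod (poly s (complex_of_real t)))\<^sup>2 = poly q t) \<and>
    (\<forall>x y. y \<ge> 0 \<longrightarrow> cmod (poly s (complex_of_real x)) \<le> cmod (poly s (complex_of_real x + \<i> * complex_of_real y)))"
  using assms
proof (induction "degree q" arbitrary: q rule: less_induct)
  case less
  \<comment> \<open>Common step of both kinds of roots: a quadratic divisor equal to \<open>|t - r|\<^sup>2\<close> on the line.\<close>
  have extend: ?case if d: "q = d * q'" "degree d = 2" "Im r \<le> 0"
    "\<And>t. poly d t = (cmod (complex_of_real t - r))\<^sup>2" for d q' r
  proof (cases "q = 0")
    case True
    then show ?thesis by (intro exI[of _ 0]) simp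
  next
    case False
    then have deg: "degree q' < degree q" using d by (auto simp: degree_mult_eq)
    have nz: "d \<noteq> 0" using d by auto
    have nn: "0 \<le> poly q' t" for t
    proof -
      have off: "0 \<le> poly q' t" if "poly d t \<noteq> 0" for t
        using less.prems[of t] that d by (auto simp: zero_le_mult_iff)
      have "\<forall>\<^sub>F s in at t. 0 \<le> poly q' s"
      proof -
        have "finite {s. poly d s = 0}" using nz by (rule poly_roots_finite)
        then have "\<forall>\<^sub>F s in at t. s \<notin> {s. poly d s = 0}"
          using islimpt_finite[of "{s. poly d s = 0}" t] by (simp add: islimpt_iff_eventually)
        then show ?thesis by (rule eventually_mono) (use off in auto)
      qed
      then show ?thesis
        by (intro tendsto_lowerbound[OF isContD[OF poly_isCont]]) auto
    qed
    obtain s where s: "\<And>t. (cmod (poly s (complex_of_real t)))\<^sup>2 = poly q' t"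
      "\<And>x y. y \<ge> 0 \<Longrightarrow> cmod (poly s (complex_of_real x)) \<le> cmod (poly s (complex_of_real x + \<i> * complex_of_real y))"
      using less.hyps[OF deg nn] by blast
    show ?thesis
    proof (intro exI[of _ "[:- r, 1:] * s"] conjI allI impI)
      fix t
      show "(cmod (poly ([:- r, 1:] * s) (complex_of_real t)))\<^sup>2 = poly q t"
        using arg_cong[OF s(1)[of t], of "\<lambda>u. (cmod (complex_of_real t - r))\<^sup>2 * u"]
        by (simp add: d(1,4) norm_mult[symmetric] power_mult_distrib[symmetric] algebra_simps)
    next
      fix x y :: real assume y: "y \<ge> 0"
      show "cmod (poly ([:- r, 1:] * s) (complex_of_real x))
          \<le> cmod (poly ([:- r, 1:] * s) (complex_of_real x + \<i> * complex_of_real y))"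
        using mult_mono[OF norm_shift_up[OF d(3) y] s(2)[OF y], of x x]
        by (simp add: norm_mult[symmetric] algebra_simps)
    qed
  qed
  show ?case
  proof (cases "degree q = 0")
    case True
    then obtain c where c: "q = [:c:]" by (rule degree_eq_zeroE)
    have "c \<ge> 0" using less.prems[of 0] c by simp
    then show ?thesis by (intro exI[of _ "[:complex_of_real (sqrt c):]"]) (simp add: c)
  next
    case False
    then have "\<not> constant (cpoly q)"
      by (simp add: constant_degree degree_map_poly)
    then obtain r where r: "cpoly q r = 0"
      using fundamental_theorem_of_algebra by blast
    show ?thesis
    proof (cases "Im r = 0")
      case True
      then obtain \<rho> where \<rho>: "r = complex_of_real \<rho>" by (metis complex_is_Real_iff Reals_cases)
      have "poly q \<rho> = 0" using r unfolding \<rho> by (simp add: cpoly_of_real)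
      then obtain q' where "q = [:- \<rho>, 1:]\<^sup>2 * q'" by (rule nonneg_poly_even_root[OF less.prems])
      then show ?thesis
        by (rule extend[where r = "complex_of_real \<rho>"])
          (auto simp: degree_power_eq simp flip: of_real_diff)
    next
      case False
      obtain q' where q': "q = [:(cmod r)\<^sup>2, - 2 * Re r, 1:] * q'"
        by (rule conj_root_quadratic[OF r False])
      show ?thesis
      proof (rule extend[OF q', where r = "if Im r \<le> 0 then r else cnj r"])
        have sq: "(cmod (complex_of_real t - w))\<^sup>2 = (cmod w)\<^sup>2 - 2 * Re w * t + t\<^sup>2" for t w
          by (simp add: cmod_power2) (simp add: power2_eq_square algebra_simps)
        show "poly [:(cmod r)\<^sup>2, - 2 * Re r, 1:] t =
            (cmod (complex_of_real t - (if Im r \<le> 0 then r else cnj r)))\<^sup>2" for t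
          using sq[of t r] sq[of t "cnj r"] by (simp add: power2_eq_square algebra_simps)
      qed auto
    qed
  qed
qed

section \<open>Joint closures in several \<open>L\<^sup>2\<close> spaces\<close>

lemma L2_functionsI:
  "f \<in> borel_measurable M \<Longrightarrow> integrable M (\<lambda>x. (cmod (f x))\<^sup>2) \<Longrightarrow> f \<in> L2_functions M"
  by (simp add: L2_functions_def)

lemma L2_functions_measurable: "f \<in> L2_functions M \<Longrightarrow> f \<in> borel_measurable M"
  and L2_functions_integrable: "f \<in> L2_functions M \<Longrightarrow> integrable M (\<lambda>x. (cmod (f x))\<^sup>2)"
  by (simp_all add: L2_functions_def)

lemma L2_functions_bound:
  assumes "f \<in> borel_measurable M" "integrable M w" "\<And>x. (cmod (f x))\<^sup>2 \<le> w x"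
  shows "f \<in> L2_functions M"
proof (rule L2_functionsI[OF assms(1)])
  note [measurable] = assms(1)
  show "integrable M (\<lambda>x. (cmod (f x))\<^sup>2)"
    by (rule Bochner_Integration.integrable_bound[OF assms(2)])
      (use assms(3) in \<open>auto intro!: AE_I2 order_trans[OF _ abs_ge_self]\<close>)
qed

lemma cmod_add_sq: "(cmod (a + b))\<^sup>2 \<le> 2 * (cmod a)\<^sup>2 + 2 * (cmod b)\<^sup>2"
proof -
  have "(cmod (a + b))\<^sup>2 \<le> (cmod a + cmod b)\<^sup>2"
    by (intro power_mono norm_triangle_ineq) simp
  also have "\<dots> \<le> 2 * (cmod a)\<^sup>2 + 2 * (cmod b)\<^sup>2"
    using zero_le_power2[of "cmod a - cmod b"] by (simp add: power2_eq_square algebra_simps)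
  finally show ?thesis .
qed

lemma L2_functions_add:
  assumes f: "f \<in> L2_functions M" and g: "g \<in> L2_functions M"
  shows "(\<lambda>x. f x + g x) \<in> L2_functions M"
    and "(\<integral>x. (cmod (f x + g x))\<^sup>2 \<partial>M) \<le> 2 * (\<integral>x. (cmod (f x))\<^sup>2 \<partial>M) + 2 * (\<integral>x. (cmod (g x))\<^sup>2 \<partial>M)"
proof -
  note [measurable] = L2_functions_measurable[OF f] L2_functions_measurable[OF g]
  note i = L2_functions_integrable[OF f] L2_functions_integrable[OF g]
  show L: "(\<lambda>x. f x + g x) \<in> L2_functions M"
    by (rule L2_functions_bound[where w = "\<lambda>x. 2 * (cmod (f x))\<^sup>2 + 2 * (cmod (g x))\<^sup>2"])
      (use i in \<open>auto intro: cmod_add_sq\<close>)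
  have "(\<integral>x. (cmod (f x + g x))\<^sup>2 \<partial>M) \<le> (\<integral>x. 2 * (cmod (f x))\<^sup>2 + 2 * (cmod (g x))\<^sup>2 \<partial>M)"
    by (rule integral_mono[OF L2_functions_integrable[OF L]]) (use i in \<open>auto intro: cmod_add_sq\<close>)
  then show "(\<integral>x. (cmod (f x + g x))\<^sup>2 \<partial>M) \<le> 2 * (\<integral>x. (cmod (f x))\<^sup>2 \<partial>M) + 2 * (\<integral>x. (cmod (g x))\<^sup>2 \<partial>M)"
    using i by simp
qed

lemma L2_functions_mult_bounded:
  assumes m: "m \<in> borel_measurable M" "\<And>x. cmod (m x) \<le> B" and f: "f \<in> L2_functions M"
  shows "(\<lambda>x. m x * f x) \<in> L2_functions M"
    and "(\<integral>x. (cmod (m x * f x))\<^sup>2 \<partial>M) \<le> B\<^sup>2 * (\<integral>x. (cmod (f x))\<^sup>2 \<partial>M)"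
proof -
  note [measurable] = L2_functions_measurable[OF f] m(1)
  note i = L2_functions_integrable[OF f]
  have le: "(cmod (m x * f x))\<^sup>2 \<le> B\<^sup>2 * (cmod (f x))\<^sup>2" for x
    unfolding norm_mult power_mult_distrib using m(2)[of x] by (intro mult_right_mono power_mono) auto
  show L: "(\<lambda>x. m x * f x) \<in> L2_functions M"
    by (rule L2_functions_bound[where w = "\<lambda>x. B\<^sup>2 * (cmod (f x))\<^sup>2"]) (use i le in auto)
  have "(\<integral>x. (cmod (m x * f x))\<^sup>2 \<partial>M) \<le> (\<integral>x. B\<^sup>2 * (cmod (f x))\<^sup>2 \<partial>M)"
    by (rule integral_mono[OF L2_functions_integrable[OF L]]) (use i le in auto)
  then show "(\<integral>x. (cmod (m x * f x))\<^sup>2 \<partial>M) \<le> B\<^sup>2 * (\<integral>x. (cmod (f x))\<^sup>2 \<partial>M)" by simp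
qed

lemma L2_functions_scale: "f \<in> L2_functions M \<Longrightarrow> (\<lambda>x. c * f x) \<in> L2_functions M"
  by (rule L2_functions_mult_bounded(1)[where B = "cmod c"]) auto

lemma L2_functions_diff:
  assumes "f \<in> L2_functions M" "g \<in> L2_functions M"
  shows "(\<lambda>x. f x - g x) \<in> L2_functions M"
  using L2_functions_add(1)[OF assms(1) L2_functions_scale[OF assms(2), of "-1"]] by simp

text \<open>
One and the same \<open>g\<close> must approximate \<open>f\<close> for all measures of the family.  This uniformity is what
allows moments to be compared in the limit.
\<close>

definition joint_L2_closure :: "'a measure set \<Rightarrow> ('a \<Rightarrow> complex) set \<Rightarrow> ('a \<Rightarrow> complex) set" where
  "joint_L2_closure \<M> S = {f. (\<forall>M\<in>\<M>. f \<in> L2_functions M) \<and>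
     (\<forall>\<epsilon>>0. \<exists>g\<in>S. \<forall>M\<in>\<M>. (\<integral>x. (cmod (f x - g x))\<^sup>2 \<partial>M) < \<epsilon>)}"

lemma joint_L2_closureI:
  "(\<And>M. M \<in> \<M> \<Longrightarrow> f \<in> L2_functions M) \<Longrightarrow>
   (\<And>\<epsilon>. \<epsilon> > 0 \<Longrightarrow> \<exists>g\<in>S. \<forall>M\<in>\<M>. (\<integral>x. (cmod (f x - g x))\<^sup>2 \<partial>M) < \<epsilon>) \<Longrightarrow> f \<in> joint_L2_closure \<M> S"
  by (simp add: joint_L2_closure_def)

lemma joint_L2_closureD:
  assumes "f \<in> joint_L2_closure \<M> S"
  shows "M \<in> \<M> \<Longrightarrow> f \<in> L2_functions M"
    and "\<epsilon> > 0 \<Longrightarrow> \<exists>g\<in>S. \<forall>M\<in>\<M>. (\<integral>x. (cmod (f x - g x))\<^sup>2 \<partial>M) < \<epsilon>"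
  using assms by (auto simp: joint_L2_closure_def)

locale L2_subspace =
  fixes \<M> :: "'a measure set" and S :: "('a \<Rightarrow> complex) set"
  assumes finite_family: "finite \<M>"
    and L2: "\<And>f M. f \<in> S \<Longrightarrow> M \<in> \<M> \<Longrightarrow> f \<in> L2_functions M"
    and add_closed: "\<And>f g. f \<in> S \<Longrightarrow> g \<in> S \<Longrightarrow> (\<lambda>x. f x + g x) \<in> S"
    and scale_closed: "\<And>f c. f \<in> S \<Longrightarrow> (\<lambda>x. c * f x) \<in> S"
begin

abbreviation H :: "('a \<Rightarrow> complex) set" where "H \<equiv> joint_L2_closure \<M> S"

lemma subset_closure: "f \<in> S \<Longrightarrow> f \<in> H"
  by (rule joint_L2_closureI) (auto intro: L2 bexI[of _ f])

lemma closure_closed: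
  assumes f: "\<And>M. M \<in> \<M> \<Longrightarrow> f \<in> L2_functions M"
    and appr: "\<And>\<epsilon>. \<epsilon> > 0 \<Longrightarrow> \<exists>g\<in>H. \<forall>M\<in>\<M>. (\<integral>x. (cmod (f x - g x))\<^sup>2 \<partial>M) < \<epsilon>"
  shows "f \<in> H"
proof (rule joint_L2_closureI[OF f])
  fix \<epsilon> :: real assume e: "\<epsilon> > 0"
  obtain g where g: "g \<in> H" "\<And>M. M \<in> \<M> \<Longrightarrow> (\<integral>x. (cmod (f x - g x))\<^sup>2 \<partial>M) < \<epsilon> / 4"
    using appr[of "\<epsilon> / 4"] e by auto
  obtain s where s: "s \<in> S" "\<And>M. M \<in> \<M> \<Longrightarrow> (\<integral>x. (cmod (g x - s x))\<^sup>2 \<partial>M) < \<epsilon> / 4"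
    using joint_L2_closureD(2)[OF g(1), of "\<epsilon> / 4"] e by auto
  have "(\<integral>x. (cmod (f x - s x))\<^sup>2 \<partial>M) < \<epsilon>" if M: "M \<in> \<M>" for M
  proof -
    have "(\<integral>x. (cmod ((f x - g x) + (g x - s x)))\<^sup>2 \<partial>M)
        \<le> 2 * (\<integral>x. (cmod (f x - g x))\<^sup>2 \<partial>M) + 2 * (\<integral>x. (cmod (g x - s x))\<^sup>2 \<partial>M)"
      using f[OF M] joint_L2_closureD(1)[OF g(1) M] L2[OF s(1) M]
      by (intro L2_functions_add(2) L2_functions_diff)
    then show ?thesis using g(2)[OF M] s(2)[OF M] by simp
  qed
  then show "\<exists>g\<in>S. \<forall>M\<in>\<M>. (\<integral>x. (cmod (f x - g x))\<^sup>2 \<partial>M) < \<epsilon>" using s(1) by blast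
qed simp

lemma closure_add:
  assumes f: "f \<in> H" and g: "g \<in> H"
  shows "(\<lambda>x. f x + g x) \<in> H"
proof (rule joint_L2_closureI)
  show "(\<lambda>x. f x + g x) \<in> L2_functions M" if "M \<in> \<M>" for M
    using joint_L2_closureD(1)[OF f that] joint_L2_closureD(1)[OF g that] by (rule L2_functions_add)
  fix \<epsilon> :: real assume e: "\<epsilon> > 0"
  obtain s where s: "s \<in> S" "\<And>M. M \<in> \<M> \<Longrightarrow> (\<integral>x. (cmod (f x - s x))\<^sup>2 \<partial>M) < \<epsilon> / 4"
    using joint_L2_closureD(2)[OF f, of "\<epsilon> / 4"] e by auto
  obtain t where t: "t \<in> S" "\<And>M. M \<in> \<M> \<Longrightarrow> (\<integral>x. (cmod (g x - t x))\<^sup>2 \<partial>M) < \<epsilon> / 4"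
    using joint_L2_closureD(2)[OF g, of "\<epsilon> / 4"] e by auto
  have "(\<integral>x. (cmod ((f x + g x) - (s x + t x)))\<^sup>2 \<partial>M) < \<epsilon>" if M: "M \<in> \<M>" for M
  proof -
    have "(\<integral>x. (cmod ((f x - s x) + (g x - t x)))\<^sup>2 \<partial>M)
        \<le> 2 * (\<integral>x. (cmod (f x - s x))\<^sup>2 \<partial>M) + 2 * (\<integral>x. (cmod (g x - t x))\<^sup>2 \<partial>M)"
      using joint_L2_closureD(1)[OF f M] joint_L2_closureD(1)[OF g M] L2[OF s(1) M] L2[OF t(1) M]
      by (intro L2_functions_add(2) L2_functions_diff)
    then show ?thesis using s(2)[OF M] t(2)[OF M] by (simp add: algebra_simps)
  qed
  then show "\<exists>h\<in>S. \<forall>M\<in>\<M>. (\<integral>x. (cmod ((f x + g x) - h x))\<^sup>2 \<partial>M) < \<epsilon>"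
    by (intro bexI[OF _ add_closed[OF s(1) t(1)]]) blast
qed

lemma closure_mult:
  assumes m: "\<And>M. M \<in> \<M> \<Longrightarrow> m \<in> borel_measurable M" "\<And>x. cmod (m x) \<le> B"
    and S: "\<And>s. s \<in> S \<Longrightarrow> (\<lambda>x. m x * s x) \<in> H" and f: "f \<in> H"
  shows "(\<lambda>x. m x * f x) \<in> H"
proof (rule closure_closed)
  show "(\<lambda>x. m x * f x) \<in> L2_functions M" if "M \<in> \<M>" for M
    by (rule L2_functions_mult_bounded[OF m(1)[OF that] m(2) joint_L2_closureD(1)[OF f that]])
  fix \<epsilon> :: real assume e: "\<epsilon> > 0"
  have pos: "B\<^sup>2 + 1 > 0" by (simp add: add_nonneg_pos)
  obtain s where s: "s \<in> S" "\<And>M. M \<in> \<M> \<Longrightarrow> (\<integral>x. (cmod (f x - s x))\<^sup>2 \<partial>M) < \<epsilon> / (B\<^sup>2 + 1)"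
    using joint_L2_closureD(2)[OF f, of "\<epsilon> / (B\<^sup>2 + 1)"] e pos by auto
  have "(\<integral>x. (cmod (m x * f x - m x * s x))\<^sup>2 \<partial>M) < \<epsilon>" if M: "M \<in> \<M>" for M
  proof -
    have "(\<integral>x. (cmod (m x * (f x - s x)))\<^sup>2 \<partial>M) \<le> B\<^sup>2 * (\<integral>x. (cmod (f x - s x))\<^sup>2 \<partial>M)"
      by (intro L2_functions_mult_bounded(2)[OF m(1)[OF M] m(2)] L2_functions_diff
          joint_L2_closureD(1)[OF f M] L2[OF s(1) M])
    also have "\<dots> \<le> (B\<^sup>2 + 1) * (\<integral>x. (cmod (f x - s x))\<^sup>2 \<partial>M)"
      by (intro mult_right_mono) auto
    also have "\<dots> < (B\<^sup>2 + 1) * (\<epsilon> / (B\<^sup>2 + 1))"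
      by (intro mult_strict_left_mono s(2)[OF M] pos)
    finally show ?thesis using pos by (simp add: right_diff_distrib)
  qed
  then show "\<exists>g\<in>H. \<forall>M\<in>\<M>. (\<integral>x. (cmod (m x * f x - g x))\<^sup>2 \<partial>M) < \<epsilon>"
    by (intro bexI[OF _ S[OF s(1)]] ballI)
qed

lemma closure_scale: "f \<in> H \<Longrightarrow> (\<lambda>x. c * f x) \<in> H"
  by (rule closure_mult[where B = "cmod c"]) (auto intro: subset_closure scale_closed)

lemma closure_dominated:
  assumes fn: "\<And>n. f n \<in> H" and lim: "\<And>x. (\<lambda>n. f n x) \<longlonglongrightarrow> g x"
    and w: "\<And>M. M \<in> \<M> \<Longrightarrow> integrable M (\<lambda>x. (w x)\<^sup>2)" and bd: "\<And>n x. cmod (f n x) \<le> w x"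
  shows "g \<in> H"
proof (rule closure_closed)
  have gw: "cmod (g x) \<le> w x" for x
    by (rule LIMSEQ_le_const2[OF tendsto_norm[OF lim]]) (use bd in auto)
  have w0: "0 \<le> w x" for x using gw[of x] by (rule order_trans[OF norm_ge_zero])
  have gm: "g \<in> borel_measurable M" if M: "M \<in> \<M>" for M
    by (rule borel_measurable_LIMSEQ_metric[OF L2_functions_measurable[OF joint_L2_closureD(1)[OF fn M]] lim])
  show gL: "g \<in> L2_functions M" if M: "M \<in> \<M>" for M
    by (rule L2_functions_bound[OF gm[OF M] w[OF M]]) (intro power_mono gw, simp)
  fix \<epsilon> :: real assume e: "\<epsilon> > 0"
  have conv: "(\<lambda>n. \<integral>x. (cmod (g x - f n x))\<^sup>2 \<partial>M) \<longlonglongrightarrow> (\<integral>x. 0 \<partial>M)" if M: "M \<in> \<M>" for M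
  proof (rule integral_dominated_convergence[where w = "\<lambda>x. 4 * (w x)\<^sup>2"])
    note [measurable] = gm[OF M] L2_functions_measurable[OF joint_L2_closureD(1)[OF fn M]]
    show "(\<lambda>x. (cmod (g x - f n x))\<^sup>2) \<in> borel_measurable M" for n by measurable
    show "integrable M (\<lambda>x. 4 * (w x)\<^sup>2)" using w[OF M] by simp
    have "(\<lambda>n. (cmod (g x - f n x))\<^sup>2) \<longlonglongrightarrow> (cmod (g x - g x))\<^sup>2" for x
      by (intro tendsto_intros lim)
    then show "AE x in M. (\<lambda>n. (cmod (g x - f n x))\<^sup>2) \<longlonglongrightarrow> 0" by simp
    have "(cmod (g x - f n x))\<^sup>2 \<le> 4 * (w x)\<^sup>2" for n x
    proof -
      have "cmod (g x - f n x) \<le> 2 * w x"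
        using norm_triangle_ineq4[of "g x" "f n x"] gw[of x] bd[of n x] by linarith
      then have "(cmod (g x - f n x))\<^sup>2 \<le> (2 * w x)\<^sup>2" by (intro power_mono) auto
      then show ?thesis by (simp add: power_mult_distrib)
    qed
    then show "AE x in M. norm ((cmod (g x - f n x))\<^sup>2) \<le> 4 * (w x)\<^sup>2" for n by simp
  qed simp
  have "\<forall>\<^sub>F n in sequentially. \<forall>M\<in>\<M>. (\<integral>x. (cmod (g x - f n x))\<^sup>2 \<partial>M) < \<epsilon>"
    using conv e by (intro eventually_ball_finite[OF finite_family] ballI order_tendstoD(2)) auto
  then obtain n where "\<forall>M\<in>\<M>. (\<integral>x. (cmod (g x - f n x))\<^sup>2 \<partial>M) < \<epsilon>"
    by (auto simp: eventually_sequentially)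
  then show "\<exists>h\<in>H. \<forall>M\<in>\<M>. (\<integral>x. (cmod (g x - h x))\<^sup>2 \<partial>M) < \<epsilon>"
    by (rule bexI[OF _ fn])
qed

end

section \<open>Density of the polynomials on the line\<close>

lemma moment_measures_real:
  assumes "M \<in> moment_measures"
  shows "sets M = sets (borel :: real measure)" and "integrable M (\<lambda>t. t ^ n)"
proof -
  show "sets M = sets (borel :: real measure)" using assms by (simp add: moment_measures_def)
  have "\<forall>\<alpha>::real \<Rightarrow> nat. integrable M (\<lambda>x. \<Prod>b\<in>Basis. (x \<bullet> b) ^ \<alpha> b)"
    using assms by (simp add: moment_measures_def)
  from this[rule_format, of "\<lambda>_. n"] show "integrable M (\<lambda>t. t ^ n)" by simp
qed

lemma moment_measures_finite:
  assumes "(M :: 'a::euclidean_space measure) \<in> moment_measures"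
  shows "finite_measure M"
proof
  have "\<forall>\<alpha>::'a \<Rightarrow> nat. integrable M (\<lambda>x. \<Prod>b\<in>Basis. (x \<bullet> b) ^ \<alpha> b)"
    using assms by (simp add: moment_measures_def)
  from this[rule_format, of "\<lambda>_. 0"] have "integrable M (\<lambda>_. 1::real)" by simp
  then show "emeasure M (space M) \<noteq> \<infinity>"
    unfolding integrable_iff_bounded by simp
qed

lemma borel_measurable_moment_measure:
  fixes f :: "'a::euclidean_space \<Rightarrow> 'b::topological_space"
  assumes "M \<in> moment_measures" "f \<in> borel_measurable borel"
  shows "f \<in> borel_measurable M"
proof -
  have "sets M = sets borel" using assms(1) by (simp add: moment_measures_def)
  from measurable_cong_sets[OF this refl] show ?thesis using assms(2) by blast
qed

lemma integrable_complex_poly: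
  fixes p :: "complex poly"
  assumes "M \<in> moment_measures"
  shows "integrable M (\<lambda>t. poly p (complex_of_real t))"
proof -
  have "integrable M (\<lambda>t. complex_of_real (t ^ n))" for n
    by (intro integrable_of_real moment_measures_real(2)[OF assms])
  then show ?thesis unfolding poly_altdef by simp
qed

lemma cmod_poly_square:
  "complex_of_real ((cmod (poly p (complex_of_real t)))\<^sup>2) =
    poly (p * map_poly cnj p) (complex_of_real t)"
proof -
  have "poly (map_poly cnj p) (complex_of_real t) = cnj (poly p (complex_of_real t))"
    using poly_cnj[of p "complex_of_real t"] by simp
  then show ?thesis by (simp add: complex_norm_square[symmetric])
qed

lemma Int_stable_intervals: "Int_stable (range (\<lambda>(a, b). {a..b :: 'a::ordered_euclidean_space}))"
proof (rule Int_stableI, elim rangeE, simp, safe)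
  fix a b c d :: 'a
  show "{a..b} \<inter> {c..d} \<in> range (\<lambda>(a, b). {a..b})"
    by (rule range_eqI[of _ _ "(sup a c, inf b d)"]) auto
qed

definition poly_functions :: "(real \<Rightarrow> complex) set" where
  "poly_functions = range (\<lambda>(p :: complex poly) t. poly p (complex_of_real t))"

lemma poly_functionsI: "(\<lambda>t. poly p (complex_of_real t)) \<in> poly_functions"
  unfolding poly_functions_def by (rule rangeI)

lemma poly_functionsE:
  assumes "f \<in> poly_functions"
  obtains p where "f = (\<lambda>t. poly p (complex_of_real t))"
  using assms unfolding poly_functions_def by (rule rangeE)

lemma borel_measurable_complex_poly: "(\<lambda>t. poly p (complex_of_real t)) \<in> borel_measurable borel"
  by (intro borel_measurable_continuous_onI continuous_intros)

lemma L2_functions_complex_poly: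
  assumes "M \<in> moment_measures"
  shows "(\<lambda>t. poly p (complex_of_real t)) \<in> L2_functions M"
proof (rule L2_functionsI)
  show "(\<lambda>t. poly p (complex_of_real t)) \<in> borel_measurable M"
    by (rule borel_measurable_moment_measure[OF assms borel_measurable_complex_poly])
  have "integrable M (\<lambda>t. complex_of_real ((cmod (poly p (complex_of_real t)))\<^sup>2))"
    unfolding cmod_poly_square by (rule integrable_complex_poly[OF assms])
  then show "integrable M (\<lambda>t. (cmod (poly p (complex_of_real t)))\<^sup>2)"
    by (simp only: complex_of_real_integrable_eq)
qed

text \<open>
The hypothesis of the density argument.  It is stated for a family because the conclusion, joint
density, is applied to pairs of measures with equal moments.
\<close>

locale one_jointly_approximable =
  fixes \<M> :: "real measure set" and z :: complex
  assumes finite: "finite \<M>"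
    and moments: "\<And>M. M \<in> \<M> \<Longrightarrow> M \<in> moment_measures"
    and nonreal: "z \<notin> \<real>"
    and approximable: "\<And>\<epsilon>. \<epsilon> > 0 \<Longrightarrow> \<exists>q. \<forall>M\<in>\<M>.
      (\<integral>t. (cmod ((complex_of_real t + z) * poly q (complex_of_real t) - 1))\<^sup>2 \<partial>M) < \<epsilon>"
begin

sublocale L2_subspace \<M> poly_functions
proof
  show "finite \<M>" by (rule finite)
  fix f assume "f \<in> poly_functions"
  then obtain p where f: "f = (\<lambda>t. poly p (complex_of_real t))" by (rule poly_functionsE)
  show "f \<in> L2_functions M" if "M \<in> \<M>" for M
    unfolding f by (rule L2_functions_complex_poly[OF moments[OF that]])
  show "(\<lambda>x. c * f x) \<in> poly_functions" for c
    using poly_functionsI[of "smult c p"] by (simp add: f)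
  fix g assume "g \<in> poly_functions"
  then obtain q where g: "g = (\<lambda>t. poly q (complex_of_real t))" by (rule poly_functionsE)
  show "(\<lambda>x. f x + g x) \<in> poly_functions"
    using poly_functionsI[of "p + q"] by (simp add: f g)
qed

definition resolvent :: "real \<Rightarrow> complex" where "resolvent t = 1 / (complex_of_real t + z)"

lemma Im_z: "Im z \<noteq> 0"
  using nonreal by (simp add: complex_is_Real_iff)

lemma denom_nonzero: "complex_of_real t + z \<noteq> 0"
  using Im_z by (simp add: complex_eq_iff)

lemma denom_ge: "\<bar>Im z\<bar> \<le> cmod (complex_of_real t + z)"
  using abs_Im_le_cmod[of "complex_of_real t + z"] by simp

lemma resolvent_bound: "cmod (resolvent t) \<le> 1 / \<bar>Im z\<bar>"
  unfolding resolvent_def norm_divide norm_one using denom_ge[of t] Im_z denom_nonzero[of t]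
  by (intro divide_left_mono mult_pos_pos) auto

lemma continuous_resolvent: "continuous_on A resolvent"
  unfolding resolvent_def using denom_nonzero by (intro continuous_intros) auto

lemma resolvent_inj: "resolvent s = resolvent t \<Longrightarrow> s = t"
  using denom_nonzero[of s] denom_nonzero[of t] by (simp add: resolvent_def field_simps)

lemma borel_resolvent: "M \<in> \<M> \<Longrightarrow> resolvent \<in> borel_measurable M"
  by (rule borel_measurable_moment_measure[OF moments borel_measurable_continuous_onI[OF continuous_resolvent]])

lemma resolvent_mem_closure: "resolvent \<in> H"
proof (rule joint_L2_closureI)
  show uL: "resolvent \<in> L2_functions M" if M: "M \<in> \<M>" for M
  proof -
    have "(\<lambda>t. resolvent t * poly 1 (complex_of_real t)) \<in> L2_functions M"
      by (rule L2_functions_mult_bounded(1)[OF borel_resolvent[OF M] resolvent_bound L2_functions_complex_poly[OF moments[OF M]]])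
    then show ?thesis by simp
  qed
  fix \<epsilon> :: real assume e: "\<epsilon> > 0"
  have "\<epsilon> * (Im z)\<^sup>2 > 0" using e Im_z by simp
  then obtain q where q: "\<And>M. M \<in> \<M> \<Longrightarrow>
      (\<integral>t. (cmod ((complex_of_real t + z) * poly q (complex_of_real t) - 1))\<^sup>2 \<partial>M) < \<epsilon> * (Im z)\<^sup>2"
    using approximable by blast
  have "(\<integral>t. (cmod (resolvent t - poly q (complex_of_real t)))\<^sup>2 \<partial>M) < \<epsilon>" if M: "M \<in> \<M>" for M
  proof -
    define g where "g = (\<lambda>t. 1 - (complex_of_real t + z) * poly q (complex_of_real t))"
    have g: "g = (\<lambda>t. poly (1 - [:z, 1:] * q) (complex_of_real t))"
      by (auto simp: g_def algebra_simps)
    have "(\<integral>t. (cmod (resolvent t * g t))\<^sup>2 \<partial>M) \<le> (1 / \<bar>Im z\<bar>)\<^sup>2 * (\<integral>t. (cmod (g t))\<^sup>2 \<partial>M)"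
      by (rule L2_functions_mult_bounded(2)[OF borel_resolvent[OF M] resolvent_bound])
        (simp only: g L2_functions_complex_poly[OF moments[OF M]])
    also have "\<dots> = (\<integral>t. (cmod (g t))\<^sup>2 \<partial>M) / (Im z)\<^sup>2"
      by (simp add: power_divide)
    also have "\<dots> < \<epsilon>"
    proof -
      have "(\<integral>t. (cmod (g t))\<^sup>2 \<partial>M) < \<epsilon> * (Im z)\<^sup>2"
        using q[OF M] by (simp add: g_def norm_minus_commute)
      then show ?thesis using Im_z by (simp add: pos_divide_less_eq)
    qed
    also have "(\<lambda>t. resolvent t * g t) = (\<lambda>t. resolvent t - poly q (complex_of_real t))"
      using denom_nonzero by (auto simp: resolvent_def g_def field_simps)
    then have "(\<integral>t. (cmod (resolvent t * g t))\<^sup>2 \<partial>M) = (\<integral>t. (cmod (resolvent t - poly q (complex_of_real t)))\<^sup>2 \<partial>M)"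
      by (simp add: fun_eq_iff)
    finally show ?thesis by simp
  qed
  then show "\<exists>g\<in>poly_functions. \<forall>M\<in>\<M>. (\<integral>t. (cmod (resolvent t - g t))\<^sup>2 \<partial>M) < \<epsilon>"
    by (intro bexI[OF _ poly_functionsI[of q]] ballI)
qed

text \<open>
For a polynomial \<open>p(t) = (t + z) r(t) + c\<close> one has \<open>p(t) / (t + z) = r(t) + c / (t + z)\<close>; boundedness of
the factor carries this over to the closure.
\<close>

lemma closure_mult_resolvent:
  assumes "f \<in> H"
  shows "(\<lambda>t. resolvent t * f t) \<in> H"
proof (rule closure_mult[OF borel_resolvent resolvent_bound _ assms])
  fix s assume "s \<in> poly_functions"
  then obtain p where s: "s = (\<lambda>t. poly p (complex_of_real t))" by (rule poly_functionsE)
  have p: "[:z, 1:] * synthetic_div p (- z) + [:poly p (- z):] = p"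
    using synthetic_div_correct'[of "- z" p] by simp
  have "poly p (complex_of_real t) =
      (complex_of_real t + z) * poly (synthetic_div p (- z)) (complex_of_real t) + poly p (- z)" for t
    using arg_cong[OF p, of "\<lambda>p. poly p (complex_of_real t)"] by (simp add: algebra_simps)
  then have "(\<lambda>t. resolvent t * s t) =
      (\<lambda>t. poly (synthetic_div p (- z)) (complex_of_real t) + poly p (- z) * resolvent t)"
    using denom_nonzero by (auto simp: s resolvent_def field_simps)
  also have "\<dots> \<in> H"
    by (intro closure_add closure_scale resolvent_mem_closure subset_closure poly_functionsI)
  finally show "(\<lambda>t. resolvent t * s t) \<in> H" .
qed

lemma closure_cnj:
  assumes f: "f \<in> H"
  shows "(\<lambda>t. cnj (f t)) \<in> H"
proof (rule joint_L2_closureI)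
  show "(\<lambda>t. cnj (f t)) \<in> L2_functions M" if "M \<in> \<M>" for M
  proof (rule L2_functionsI)
    note fL = joint_L2_closureD(1)[OF f that]
    have "cnj \<in> borel_measurable borel" by (intro borel_measurable_continuous_onI continuous_intros)
    from measurable_compose[OF L2_functions_measurable[OF fL] this]
    show "(\<lambda>t. cnj (f t)) \<in> borel_measurable M" .
    show "integrable M (\<lambda>t. (cmod (cnj (f t)))\<^sup>2)" using L2_functions_integrable[OF fL] by simp
  qed
  fix \<epsilon> :: real assume "\<epsilon> > 0"
  from joint_L2_closureD(2)[OF f this] obtain p where
    p: "\<forall>M\<in>\<M>. (\<integral>t. (cmod (f t - poly p (complex_of_real t)))\<^sup>2 \<partial>M) < \<epsilon>"
    by (elim bexE poly_functionsE) simp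
  have "cmod (cnj (f t) - poly (map_poly cnj p) (complex_of_real t)) = cmod (f t - poly p (complex_of_real t))" for t
  proof -
    have "cnj (f t) - poly (map_poly cnj p) (complex_of_real t) = cnj (f t - poly p (complex_of_real t))"
      using poly_cnj[of p "complex_of_real t"] by simp
    then show ?thesis by (simp only: complex_mod_cnj)
  qed
  then show "\<exists>g\<in>poly_functions. \<forall>M\<in>\<M>. (\<integral>t. (cmod (cnj (f t) - g t))\<^sup>2 \<partial>M) < \<epsilon>"
    using p by (intro bexI[OF _ poly_functionsI[of "map_poly cnj p"]] ballI) simp
qed

text \<open>
Here \<open>F\<close> is a polynomial in the real and imaginary parts of a complex number.  Both parts are
linear combinations of the resolvent and its conjugate, and conjugation preserves the closure.
\<close>

lemma closure_mult_real_polynomial: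
  assumes "real_polynomial_function F" "f \<in> H"
  shows "(\<lambda>t. complex_of_real (F (resolvent t)) * f t) \<in> H"
  using assms
proof (induction F arbitrary: f rule: real_polynomial_function.induct)
  case (linear F)
  \<comment> \<open>With this \<open>a\<close> one has \<open>F w = 2 Re (a w)\<close>.\<close>
  define a where "a = (complex_of_real (F 1) - \<i> * complex_of_real (F \<i>)) / 2"
  have F: "complex_of_real (F w) = a * w + cnj a * cnj w" for w
  proof -
    interpret bounded_linear F by fact
    have w: "w = Re w *\<^sub>R 1 + Im w *\<^sub>R \<i>" by (simp add: complex_eq_iff)
    have "F w = Re w * F 1 + Im w * F \<i>"
      by (subst w) (simp only: add scaleR real_scaleR_def)
    then show ?thesis by (simp add: a_def complex_eq_iff field_simps)
  qed
  have "(\<lambda>t. a * (resolvent t * f t) + cnj a * cnj (resolvent t * cnj (f t))) \<in> H"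
    by (intro closure_add closure_scale closure_cnj closure_mult_resolvent linear)
  then show ?case by (simp add: F algebra_simps)
next
  case (const c)
  then show ?case by (intro closure_scale)
next
  case (add F G)
  from closure_add[OF add.IH(1)[OF add.prems] add.IH(2)[OF add.prems]]
  show ?case by (simp add: algebra_simps)
next
  case (mult F G)
  from mult.IH(1)[OF mult.IH(2)[OF mult.prems]]
  show ?case by (simp add: mult.assoc)
qed

lemma one_in_closure: "(\<lambda>_. 1) \<in> H"
  using subset_closure[OF poly_functionsI[of 1]] by simp

lemma const_integrable: "M \<in> \<M> \<Longrightarrow> integrable M (\<lambda>_. c :: real)"
  by (rule finite_measure.integrable_const[OF moment_measures_finite[OF moments]])

text \<open>
The resolvent takes its values in the compact disc of radius \<open>1 / |Im z|\<close>, on which \<open>F\<close> is a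
uniform limit of polynomials.
\<close>

lemma continuous_in_closure:
  assumes F: "continuous_on UNIV F" "\<And>w. \<bar>F w\<bar> \<le> 1"
  shows "(\<lambda>t. complex_of_real (F (resolvent t))) \<in> H"
proof -
  have "\<exists>g. real_polynomial_function g \<and> (\<forall>w\<in>cball 0 (1 / \<bar>Im z\<bar>). \<bar>F w - g w\<bar> < 1 / real (Suc n))" for n
  proof -
    obtain g where "real_polynomial_function g" "\<And>w. w \<in> cball 0 (1 / \<bar>Im z\<bar>) \<Longrightarrow> \<bar>F w - g w\<bar> < 1 / real (Suc n)"
      by (rule Stone_Weierstrass_real_polynomial_function[of "cball 0 (1 / \<bar>Im z\<bar>)" F "1 / real (Suc n)"])
        (auto intro: continuous_on_subset[OF F(1)])
    then show ?thesis by blast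
  qed
  then obtain g where "\<forall>n. real_polynomial_function (g n) \<and>
      (\<forall>w\<in>cball 0 (1 / \<bar>Im z\<bar>). \<bar>F w - g n w\<bar> < 1 / real (Suc n))"
    by (rule choice[OF allI, THEN exE])
  then have g: "real_polynomial_function (g n)"
    "w \<in> cball 0 (1 / \<bar>Im z\<bar>) \<Longrightarrow> \<bar>F w - g n w\<bar> < 1 / real (Suc n)" for n w
    by auto
  have d: "\<bar>F (resolvent t) - g n (resolvent t)\<bar> < 1 / real (Suc n)" for n t
    using resolvent_bound[of t] by (intro g(2)) simp
  show ?thesis
  proof (rule closure_dominated[where w = "\<lambda>_. 2"])
    show "(\<lambda>t. complex_of_real (g n (resolvent t))) \<in> H" for n
      using closure_mult_real_polynomial[OF g(1) one_in_closure, of n] by simp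
    show "integrable M (\<lambda>_. (2 :: real)\<^sup>2)" if "M \<in> \<M>" for M by (rule const_integrable[OF that])
    have "(\<lambda>n. g n (resolvent t) - F (resolvent t)) \<longlonglongrightarrow> 0" for t
      by (rule Lim_null_comparison[OF _ LIMSEQ_Suc[OF lim_1_over_n]])
        (use d[of t] in \<open>auto simp: abs_minus_commute intro!: always_eventually less_imp_le\<close>)
    then show "(\<lambda>n. complex_of_real (g n (resolvent t))) \<longlonglongrightarrow> complex_of_real (F (resolvent t))" for t
      by (intro tendsto_of_real) (simp add: LIM_zero_iff)
    show "cmod (complex_of_real (g n (resolvent t))) \<le> 2" for n t
    proof -
      have "1 / real (Suc n) \<le> 1" by simp
      then show ?thesis using d[of t n] F(2)[of "resolvent t"] unfolding norm_of_real by linarith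
    qed
  qed
qed

text \<open>
The resolvent is injective, so the indicator of a compact interval is the indicator of its compact
image composed with the resolvent; the latter is a limit of continuous functions of the distance
to the image.
\<close>

lemma interval_in_closure: "(\<lambda>t. complex_of_real (indicat_real {a..b} t)) \<in> H"
proof (cases "{a..b} = {}")
  case True
  then show ?thesis using closure_scale[OF one_in_closure, of 0] by simp
next
  case False
  define C where "C = resolvent ` {a..b}"
  have C: "closed C" "C \<noteq> {}"
    using False by (auto simp: C_def intro!: compact_imp_closed compact_continuous_image continuous_resolvent)
  \<comment> \<open>These decrease to the indicator of \<open>C\<close>.\<close>
  define F where "F = (\<lambda>n w. max 0 (1 - real n * infdist w C))"
  show ?thesis
  proof (rule closure_dominated[where w = "\<lambda>_. 1"])
    show "(\<lambda>t. complex_of_real (F n (resolvent t))) \<in> H" for n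
    proof (rule continuous_in_closure)
      show "continuous_on UNIV (F n)" unfolding F_def by (intro continuous_intros)
      show "\<bar>F n w\<bar> \<le> 1" for w using infdist_nonneg[of w C] by (simp add: F_def)
    qed
    show "integrable M (\<lambda>_. (1 :: real)\<^sup>2)" if "M \<in> \<M>" for M by (rule const_integrable[OF that])
    show "(\<lambda>n. complex_of_real (F n (resolvent t))) \<longlonglongrightarrow> complex_of_real (indicat_real {a..b} t)" for t
    proof (rule tendsto_of_real, rule tendsto_eventually)
      have mem: "resolvent t \<in> C \<longleftrightarrow> t \<in> {a..b}" unfolding C_def by (auto dest!: resolvent_inj)
      show "\<forall>\<^sub>F n in sequentially. F n (resolvent t) = indicat_real {a..b} t"
      proof (cases "t \<in> {a..b}")
        case True
        then have "infdist (resolvent t) C = 0" using mem by simp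
        then show ?thesis using True by (simp add: F_def)
      next
        case False
        then have pos: "infdist (resolvent t) C > 0"
          using mem C by (metis infdist_pos_not_in_closed)
        obtain N :: nat where N: "1 / infdist (resolvent t) C < real N" using reals_Archimedean2 by blast
        have "F n (resolvent t) = 0" if "n \<ge> N" for n
        proof -
          have "1 / infdist (resolvent t) C < real n" using N that by simp
          then show ?thesis using pos by (simp add: F_def field_simps)
        qed
        then show ?thesis using False by (intro eventually_sequentiallyI[of N]) simp
      qed
    qed
    show "cmod (complex_of_real (F n (resolvent t))) \<le> 1" for n t
      using infdist_nonneg[of "resolvent t" C] by (simp add: F_def)
  qed
qed

lemma borel_set_in_closure:
  assumes "A \<in> sets borel"
  shows "(\<lambda>t. complex_of_real (indicat_real A t)) \<in> H"
proof -
  have "range (\<lambda>(a, b). {a..b::real}) \<subseteq> Pow UNIV" by simp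
  moreover have "A \<in> sigma_sets UNIV (range (\<lambda>(a, b). {a..b::real}))"
    using assms unfolding borel_eq_atLeastAtMost by simp
  ultimately show ?thesis
  proof (induction rule: sigma_sets_induct_disjoint[OF Int_stable_intervals, consumes 2, case_names basic empty compl union])
    case (basic A)
    then show ?case using interval_in_closure by auto
  next
    case empty
    then show ?case using closure_scale[OF one_in_closure, of 0] by simp
  next
    case (compl A)
    have "(\<lambda>t. 1 + (-1) * complex_of_real (indicat_real A t)) \<in> H"
      by (intro closure_add closure_scale one_in_closure compl)
    also have "(\<lambda>t. 1 + (-1) * complex_of_real (indicat_real A t)) =
        (\<lambda>t. complex_of_real (indicat_real (UNIV - A) t))" by (auto simp: indicator_def)
    finally show ?case .
  next
    case (union A)
    show ?case
    proof (rule closure_dominated[where w = "\<lambda>_. 1"])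
      have fin: "(\<lambda>t. complex_of_real (indicat_real (\<Union>i<n. A i) t)) \<in> H" for n
      proof (induction n)
        case 0
        then show ?case using closure_scale[OF one_in_closure, of 0] by simp
      next
        case (Suc n)
        have "(\<lambda>t. complex_of_real (indicat_real (\<Union>i<n. A i) t) + complex_of_real (indicat_real (A n) t)) \<in> H"
          by (intro closure_add Suc union)
        also have "(\<lambda>t. complex_of_real (indicat_real (\<Union>i<n. A i) t) + complex_of_real (indicat_real (A n) t)) =
            (\<lambda>t. complex_of_real (indicat_real (\<Union>i<Suc n. A i) t))"
        proof
          fix t
          have "\<not> (t \<in> (\<Union>i<n. A i) \<and> t \<in> A n)"
            using disjoint_family_onD[OF union(1), of _ n] by fastforce
          then show "complex_of_real (indicat_real (\<Union>i<n. A i) t) + complex_of_real (indicat_real (A n) t) =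
              complex_of_real (indicat_real (\<Union>i<Suc n. A i) t)"
            by (auto simp: indicator_def less_Suc_eq)
        qed
        finally show ?case .
      qed
      show "(\<lambda>t. complex_of_real (indicat_real (\<Union>i<n. A i) t)) \<in> H" for n by (rule fin)
      show "integrable M (\<lambda>_. (1 :: real)\<^sup>2)" if "M \<in> \<M>" for M by (rule const_integrable[OF that])
      show "(\<lambda>n. complex_of_real (indicat_real (\<Union>i<n. A i) t)) \<longlonglongrightarrow> complex_of_real (indicat_real (\<Union>i. A i) t)" for t
        by (intro tendsto_of_real LIMSEQ_indicator_UN)
      show "cmod (complex_of_real (indicat_real (\<Union>i<n. A i) t)) \<le> 1" for n t
        by (simp add: indicator_def)
    qed
  qed
qed

lemma simple_in_closure:
  assumes s: "simple_function borel (s :: real \<Rightarrow> complex)"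
  shows "s \<in> H"
proof -
  have fin: "finite (range s)" using s by (simp add: simple_function_def)
  have meas: "s -` {y} \<in> sets borel" for y
    using simple_functionD(2)[OF s, of "{y}"] by simp
  have "(\<lambda>t. \<Sum>y\<in>Y. y * complex_of_real (indicat_real (s -` {y}) t)) \<in> H" if "finite Y" for Y
    using that
  proof induction
    case empty
    then show ?case using closure_scale[OF one_in_closure, of 0] by simp
  next
    case (insert y Y)
    then show ?case
      using closure_add[OF closure_scale[OF borel_set_in_closure[OF meas]] insert.IH] by simp
  qed
  from this[OF fin] have "(\<lambda>t. \<Sum>y\<in>range s. y * complex_of_real (indicat_real (s -` {y}) t)) \<in> H" .
  also have "(\<lambda>t. \<Sum>y\<in>range s. y * complex_of_real (indicat_real (s -` {y}) t)) = s"
  proof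
    fix t
    have "(\<Sum>y\<in>range s. y * complex_of_real (indicat_real (s -` {y}) t)) = (\<Sum>y\<in>range s. if y = s t then y else 0)"
      by (rule sum.cong) (auto simp: indicator_def)
    then show "(\<Sum>y\<in>range s. y * complex_of_real (indicat_real (s -` {y}) t)) = s t"
      using fin by simp
  qed
  finally show ?thesis .
qed

text \<open>
Indicators of Borel sets give simple functions, and \<open>f\<close> is a pointwise limit of simple functions
dominated by \<open>2|f|\<close>.
\<close>

theorem polynomials_dense:
  assumes f: "f \<in> borel_measurable borel" "\<And>M. M \<in> \<M> \<Longrightarrow> f \<in> L2_functions M"
  shows "f \<in> H"
proof -
  obtain s where s: "\<And>i. simple_function borel (s i)" "\<And>t. (\<lambda>i. s i t) \<longlonglongrightarrow> f t"
    "\<And>i t. dist (s i t) 0 \<le> 2 * dist (f t) 0"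
    using borel_measurable_implies_sequence_metric[OF f(1), of 0] by auto
  show ?thesis
  proof (rule closure_dominated[where w = "\<lambda>t. 2 * cmod (f t)"])
    show "s i \<in> H" for i by (rule simple_in_closure[OF s(1)])
    show "integrable M (\<lambda>t. (2 * cmod (f t))\<^sup>2)" if "M \<in> \<M>" for M
      using L2_functions_integrable[OF f(2)[OF that]] by (simp add: power_mult_distrib)
  qed (use s in auto)
qed

end

section \<open>Polynomial functions and moments\<close>

text \<open>
Only integrals of monomials are given.  The inductive definition of polynomial functions is
followed with an arbitrary further factor \<open>g\<close>, so that products need no expansion: multiplication
by a coordinate only raises an exponent.
\<close>

lemma integrable_polynomial_times_monomial:
  fixes p :: "'a::euclidean_space \<Rightarrow> real"
  assumes "real_polynomial_function p"
    and "\<And>\<alpha> :: 'a \<Rightarrow> nat. integrable M (\<lambda>x. g x * (\<Prod>b\<in>Basis. (x \<bullet> b) ^ \<alpha> b))"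
  shows "integrable M (\<lambda>x. p x * g x * (\<Prod>b\<in>Basis. (x \<bullet> b) ^ \<alpha> b))"
  using assms
proof (induction p arbitrary: g \<alpha> rule: real_polynomial_function.induct)
  case (linear f)
  have fx: "f x = (\<Sum>c\<in>Basis. (x \<bullet> c) * f c)" for x
  proof -
    interpret bounded_linear f by fact
    have "f x = f (\<Sum>c\<in>Basis. (x \<bullet> c) *\<^sub>R c)" by (simp add: euclidean_representation)
    then show ?thesis by (simp add: sum scaleR)
  qed
  have "(x \<bullet> c) * (\<Prod>b\<in>Basis. (x \<bullet> b) ^ \<alpha> b) = (\<Prod>b\<in>Basis. (x \<bullet> b) ^ (\<alpha>(c := Suc (\<alpha> c))) b)"
    if c: "c \<in> Basis" for c x
  proof -
    have "(\<Prod>b\<in>Basis - {c}. (x \<bullet> b) ^ (\<alpha>(c := Suc (\<alpha> c))) b) = (\<Prod>b\<in>Basis - {c}. (x \<bullet> b) ^ \<alpha> b)"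
      by (rule prod.cong) auto
    then show ?thesis
      by (simp only: prod.remove[OF finite_Basis c] fun_upd_same power_Suc mult.assoc)
  qed
  then have "f x * g x * (\<Prod>b\<in>Basis. (x \<bullet> b) ^ \<alpha> b) =
      (\<Sum>c\<in>Basis. f c * (g x * (\<Prod>b\<in>Basis. (x \<bullet> b) ^ (\<alpha>(c := Suc (\<alpha> c))) b)))" for x
    unfolding fx[of x] sum_distrib_right by (intro sum.cong refl) (simp add: algebra_simps)
  then show ?case
    using linear.prems by (simp only:) (intro Bochner_Integration.integrable_sum integrable_mult_right)
next
  case (const c)
  then show ?case using integrable_mult_right[OF const(1)[of \<alpha>], of c] by (simp add: mult.assoc)
next
  case (add p q)
  from Bochner_Integration.integrable_add[OF add.IH(1)[OF add.prems] add.IH(2)[OF add.prems]]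
  show ?case by (simp add: algebra_simps)
next
  case (mult p q)
  from mult.IH(1)[OF mult.IH(2)[OF mult.prems]]
  show ?case by (simp add: mult.assoc)
qed

lemma integrable_real_polynomial_function:
  fixes p :: "'a::euclidean_space \<Rightarrow> real"
  assumes M: "M \<in> moment_measures" and p: "real_polynomial_function p"
  shows "integrable M p"
proof -
  have "integrable M (\<lambda>x. 1 * (\<Prod>b\<in>Basis. (x \<bullet> b) ^ \<alpha> b))" for \<alpha> :: "'a \<Rightarrow> nat"
    using M by (simp add: moment_measures_def)
  from integrable_polynomial_times_monomial[OF p this, of "\<lambda>_. 0"] show ?thesis by simp
qed

lemma polynomial_function_complex_iff:
  fixes p :: "'a::real_normed_vector \<Rightarrow> complex"
  shows "polynomial_function p \<longleftrightarrow>
    real_polynomial_function (\<lambda>x. Re (p x)) \<and> real_polynomial_function (\<lambda>x. Im (p x))"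
  by (simp add: polynomial_function_iff_Basis_inner Basis_complex_def inner_complex_def)

lemma polynomial_function_complex_mult:
  fixes p q :: "'a::real_normed_vector \<Rightarrow> complex"
  assumes "polynomial_function p" "polynomial_function q"
  shows "polynomial_function (\<lambda>x. p x * q x)"
  using assms unfolding polynomial_function_complex_iff by auto

lemma polynomial_function_poly_comp:
  assumes f: "real_polynomial_function f"
  shows "polynomial_function (\<lambda>x. poly Q (complex_of_real (f x)))"
proof (induction Q)
  case (pCons a Q)
  have "polynomial_function (\<lambda>x. complex_of_real (f x))"
    using f by (simp add: polynomial_function_complex_iff real_polynomial_function.intros(2))
  from polynomial_function_add[OF polynomial_function_const polynomial_function_complex_mult[OF this pCons.IH]]
  show ?case by simp
qed simp

lemma integrable_polynomial_function:
  fixes p :: "'a::euclidean_space \<Rightarrow> complex"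
  assumes M: "M \<in> moment_measures" and p: "polynomial_function p"
  shows "integrable M p" and "integrable M (\<lambda>x. (cmod (p x))\<^sup>2)"
proof -
  have r: "real_polynomial_function (\<lambda>x. Re (p x))" "real_polynomial_function (\<lambda>x. Im (p x))"
    using p by (simp_all add: polynomial_function_complex_iff)
  have "integrable M (\<lambda>x. complex_of_real (Re (p x)) + \<i> * complex_of_real (Im (p x)))"
    by (intro Bochner_Integration.integrable_add integrable_mult_right integrable_of_real
        integrable_real_polynomial_function[OF M] r)
  then show "integrable M p" by (simp add: complex_eq[symmetric])
  have "real_polynomial_function (\<lambda>x. Re (p x) * Re (p x) + Im (p x) * Im (p x))"
    using r by auto
  moreover have "(cmod (p x))\<^sup>2 = Re (p x) * Re (p x) + Im (p x) * Im (p x)" for x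
    by (subst cmod_power2) (simp only: power2_eq_square)
  ultimately show "integrable M (\<lambda>x. (cmod (p x))\<^sup>2)"
    using integrable_real_polynomial_function[OF M] by (simp only:)
qed

lemma borel_measurable_real_polynomial_function:
  fixes f :: "'a::euclidean_space \<Rightarrow> real"
  assumes "real_polynomial_function f"
  shows "f \<in> borel_measurable borel"
  using assms by (intro borel_measurable_continuous_onI continuous_on_polymonial_function)
    (simp add: real_polynomial_function_eq)

lemma distr_moment_measures:
  assumes M: "M \<in> moment_measures" and f: "real_polynomial_function f"
  shows "distr M borel f \<in> moment_measures"
proof -
  have fM: "f \<in> borel_measurable M"
    by (rule borel_measurable_moment_measure[OF M borel_measurable_real_polynomial_function[OF f]])
  have "integrable (distr M borel f) (\<lambda>t. t ^ n)" for n
    by (subst integrable_distr_eq[OF fM])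
      (auto intro!: integrable_real_polynomial_function[OF M] real_polynomial_function_power f)
  then show ?thesis by (simp add: moment_measures_def)
qed

lemma moment_measures_realI:
  assumes "sets M = sets borel" "\<And>p. integrable M (poly p)"
  shows "(M :: real measure) \<in> moment_measures"
proof -
  have "integrable M (\<lambda>t. t ^ n)" for n
    using assms(2)[of "monom 1 n"] by (simp add: poly_monom[abs_def])
  then show ?thesis using assms(1) by (simp add: moment_measures_def)
qed

lemma real_polynomial_function_imp_poly:
  fixes f :: "real \<Rightarrow> real"
  assumes "real_polynomial_function f"
  obtains p where "f = poly p"
proof -
  obtain a n where "f = (\<lambda>x. \<Sum>i\<le>n. a i * x ^ i)"
    using assms real_polynomial_function_iff_sum by blast
  then have "f = poly (\<Sum>i\<le>n. monom (a i) i)"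
    by (auto simp: poly_sum poly_monom)
  then show thesis by (rule that)
qed

lemma moment_equivalent_realI:
  assumes N: "N \<in> moment_measures" and M: "M \<in> moment_measures"
    and eq: "\<And>p. integral\<^sup>L N (poly p) = integral\<^sup>L M (poly p)"
  shows "(N :: real measure) \<cong>\<^sub>m M"
  unfolding moment_equivalent_def moment_functional_def
proof (intro allI impI)
  fix p :: "real \<Rightarrow> complex" assume p: "polynomial_function p"
  obtain a where a: "(\<lambda>t. Re (p t)) = poly a"
    using p real_polynomial_function_imp_poly unfolding polynomial_function_complex_iff by blast
  obtain b where b: "(\<lambda>t. Im (p t)) = poly b"
    using p real_polynomial_function_imp_poly unfolding polynomial_function_complex_iff by blast
  have "integral\<^sup>L N p = Complex (integral\<^sup>L N (poly a)) (integral\<^sup>L N (poly b))"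
    unfolding a[symmetric] b[symmetric] using integrable_polynomial_function(1)[OF N p]
    by (simp add: complex_eq_iff)
  moreover have "integral\<^sup>L M p = Complex (integral\<^sup>L M (poly a)) (integral\<^sup>L M (poly b))"
    unfolding a[symmetric] b[symmetric] using integrable_polynomial_function(1)[OF M p]
    by (simp add: complex_eq_iff)
  ultimately show "integral\<^sup>L N p = integral\<^sup>L M p" by (simp add: eq)
qed

section \<open>Moment-equivalent measures on polynomial images\<close>

text \<open>
Otherwise \<open>q \<mapsto> \<integral>q d\<rho> - c q(x0)\<close> is nonnegative on nonnegative polynomials.  A positive extension of
it, plus \<open>c\<close> times evaluation at \<open>x0\<close>, has a representing measure with the moments of \<open>\<rho>\<close> and
mass at least \<open>c\<close> at \<open>x0\<close>.
\<close>

lemma determinate_small_nonneg_poly: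
  fixes \<rho> :: "real measure"
  assumes det: "determinate_on UNIV \<rho>" and x0: "measure \<rho> {x0} = 0" and c: "c > 0"
  obtains q :: "real poly" where "\<And>t. 0 \<le> poly q t" "integral\<^sup>L \<rho> (poly q) < c * poly q x0"
proof (rule ccontr)
  assume "\<not> thesis"
  with that have no: "c * poly q x0 \<le> integral\<^sup>L \<rho> (poly q)" if "\<And>t. 0 \<le> poly q t" for q
    using that not_le by blast
  have mom: "\<rho> \<in> moment_measures"
    using det by (simp add: determinate_on_def moment_measures_on_def)
  have int: "integrable \<rho> (poly p)" for p
    by (rule integrable_real_polynomial_function[OF mom])
      (auto simp: real_polynomial_function_iff_sum poly_altdef fun_eq_iff)
  define L where "L = (\<lambda>p. integral\<^sup>L \<rho> (poly p) - c * poly p x0)"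
  obtain \<Lambda>0 where \<Lambda>0: "positive_functional \<Lambda>0" "\<And>p. \<Lambda>0 (poly p) = L p"
  proof (rule M_Riesz_extension)
    show "L (p + q) = L p + L q" for p q
      using Bochner_Integration.integral_add[OF int[of p] int[of q]]
      by (simp add: L_def poly_add[abs_def] algebra_simps)
    show "L (smult d p) = d * L p" for d p
      by (simp add: L_def algebra_simps poly_smult[abs_def])
    show "0 \<le> L p" if "\<And>x. 0 \<le> poly p x" for p
      using no[OF that] by (simp add: L_def)
  qed blast
  interpret \<Lambda>0: positive_functional \<Lambda>0 by (rule \<Lambda>0(1))
  \<comment> \<open>On polynomials \<open>\<Lambda>\<close> is integration against \<open>\<rho>\<close>, but it charges the point \<open>x0\<close>.\<close>
  define \<Lambda> where "\<Lambda> = (\<lambda>f::real \<Rightarrow> real. \<Lambda>0 f + c * f x0)"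
  interpret \<Lambda>: positive_functional \<Lambda>
  proof
    show "linear_functional_on poly_bounded \<Lambda>"
      unfolding linear_functional_on_def \<Lambda>_def
      by (intro conjI ballI allI) (simp_all add: \<Lambda>0.add \<Lambda>0.scale algebra_simps)
    show "0 \<le> \<Lambda> f" if "f \<in> poly_bounded" "\<And>x. 0 \<le> f x" for f
      using \<Lambda>0.pos[OF that] that(2)[of x0] c by (simp add: \<Lambda>_def)
  qed
  have rep: "integral\<^sup>L \<Lambda>.rep_measure (poly p) = integral\<^sup>L \<rho> (poly p)" for p
    unfolding \<Lambda>.representation by (simp add: \<Lambda>_def \<Lambda>0(2) L_def)
  have mom': "\<Lambda>.rep_measure \<in> moment_measures"
    by (rule moment_measures_realI) (simp_all add: \<Lambda>.representation(1))
  have "\<Lambda>.rep_measure \<cong>\<^sub>m \<rho>"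
    by (rule moment_equivalent_realI[OF mom' mom rep])
  then have eq: "\<Lambda>.rep_measure = \<rho>"
    using det mom' by (simp add: determinate_on_def moment_measures_on_def)
  have "c \<le> \<Lambda> (indicat_real {x0})"
    using \<Lambda>0.pos[of "indicat_real {x0}"] by (simp add: \<Lambda>_def)
  also have "\<dots> \<le> measure \<rho> {x0}" using \<Lambda>.rep_measure_singleton[of x0] by (simp only: eq)
  finally show False using x0 c by simp
qed

definition one_in_multiples_closure :: "real measure \<Rightarrow> complex \<Rightarrow> bool" where
  "one_in_multiples_closure \<rho> z \<longleftrightarrow> (\<forall>\<epsilon>>0. \<exists>q. 
     (\<integral>t. (cmod ((complex_of_real t + z) * poly q (complex_of_real t) - 1))\<^sup>2 \<partial>\<rho>) < \<epsilon>)"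

text \<open>
At a non-atom \<open>x0\<close>, nonnegative polynomials with value \<open>1\<close> have arbitrarily small integral.  The square roots furnished by
\<open>nonneg_poly_factorization\<close> move this from the real point \<open>x0\<close> to the nonreal point \<open>x0 + \<i>\<close>.
\<close>

theorem determinate_imp_one_in_multiples_closure:
  assumes det: "determinate_on UNIV \<rho>"
  shows "\<exists>z. z \<notin> \<real> \<and> one_in_multiples_closure \<rho> z"
proof -
  have mom: "\<rho> \<in> moment_measures"
    using det by (simp add: determinate_on_def moment_measures_on_def)
  interpret finite_measure \<rho> by (rule moment_measures_finite[OF mom])
  obtain x0 where x0: "measure \<rho> {x0} = 0"
    using countable_support uncountable_UNIV_real by (metis (mono_tags, lifting) UNIV_eq_I mem_Collect_eq)
  define w where "w = complex_of_real x0 + \<i>"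
  have "\<exists>q. (\<integral>t. (cmod ((complex_of_real t + - w) * poly q (complex_of_real t) - 1))\<^sup>2 \<partial>\<rho>) < \<epsilon>"
    if e: "\<epsilon> > 0" for \<epsilon>
  proof -
    obtain q where q: "\<And>t. 0 \<le> poly q t" "integral\<^sup>L \<rho> (poly q) < \<epsilon> * poly q x0"
      using determinate_small_nonneg_poly[OF det x0 e] by blast
    have "0 \<le> integral\<^sup>L \<rho> (poly q)" by (rule Bochner_Integration.integral_nonneg) (rule q)
    then have "0 < \<epsilon> * poly q x0" using q(2) by linarith
    then have q0: "0 < poly q x0" using e by (simp add: zero_less_mult_iff)
    obtain s where s: "\<And>t. (cmod (poly s (complex_of_real t)))\<^sup>2 = poly q t"
      "\<And>x y. y \<ge> 0 \<Longrightarrow> cmod (poly s (complex_of_real x)) \<le> cmod (poly s (complex_of_real x + \<i> * complex_of_real y))"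
      using nonneg_poly_factorization[OF q(1)] by blast
    \<comment> \<open>Evaluating \<open>s\<close> above \<open>x0\<close> can only increase its modulus, so \<open>|K|\<^sup>2 \<ge> q(x0)\<close>.\<close>
    define K where "K = poly s w"
    have "poly q x0 \<le> (cmod K)\<^sup>2"
      unfolding s(1)[symmetric] using s(2)[of 1 x0] by (intro power_mono) (simp_all add: K_def w_def)
    with q0 have K: "0 < (cmod K)\<^sup>2" "poly q x0 \<le> (cmod K)\<^sup>2" "K \<noteq> 0" by auto
    have "poly (1 - smult (1 / K) s) w = 0" using K(3) by (simp add: K_def)
    then have "[:- w, 1:] dvd 1 - smult (1 / K) s" by (simp only: poly_eq_0_iff_dvd)
    then obtain r where r: "1 - smult (1 / K) s = [:- w, 1:] * r" by (rule dvdE)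
    have "(complex_of_real t + - w) * poly r (complex_of_real t) - 1 = - (poly s (complex_of_real t) / K)" for t
      using arg_cong[OF r, of "\<lambda>p. poly p (complex_of_real t)"] by (simp add: algebra_simps)
    then have "(cmod ((complex_of_real t + - w) * poly r (complex_of_real t) - 1))\<^sup>2 = poly q t / (cmod K)\<^sup>2" for t
      by (simp only: norm_minus_cancel norm_divide power_divide s(1))
    then have "(\<integral>t. (cmod ((complex_of_real t + - w) * poly r (complex_of_real t) - 1))\<^sup>2 \<partial>\<rho>)
        = integral\<^sup>L \<rho> (poly q) / (cmod K)\<^sup>2" by (simp only: integral_divide_zero)
    also have "\<dots> < \<epsilon>"
    proof -
      have "\<epsilon> * poly q x0 \<le> \<epsilon> * (cmod K)\<^sup>2" using K(2) e by simp
      then show ?thesis using q(2) K(1) by (simp add: pos_divide_less_eq)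
    qed
    finally show ?thesis by blast
  qed
  then have "one_in_multiples_closure \<rho> (- w)" by (simp add: one_in_multiples_closure_def)
  moreover have "- w \<notin> \<real>" by (simp add: w_def complex_is_Real_iff)
  ultimately show ?thesis by blast
qed

text \<open>
The squared distance of \<open>(t + z) q(t)\<close> from \<open>1\<close> is a moment, so a measure with the same moments has
the same distance.
\<close>

lemma one_jointly_approximable_distr:
  fixes \<mu> \<nu> :: "'a::euclidean_space measure"
  assumes mom: "\<mu> \<in> moment_measures" "\<nu> \<in> moment_measures" and eq: "\<nu> \<cong>\<^sub>m \<mu>"
    and f: "real_polynomial_function f" and z: "z \<notin> \<real>" and res: "one_in_multiples_closure (distr \<mu> borel f) z"
  shows "one_jointly_approximable {distr \<mu> borel f, distr \<nu> borel f} z"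
proof
  show "finite {distr \<mu> borel f, distr \<nu> borel f}" by simp
  show "M \<in> moment_measures" if "M \<in> {distr \<mu> borel f, distr \<nu> borel f}" for M
    using that distr_moment_measures[OF mom(1) f] distr_moment_measures[OF mom(2) f] by auto
  show "z \<notin> \<real>" by (rule z)
  fix \<epsilon> :: real assume "\<epsilon> > 0"
  then obtain q where q: "(\<integral>t. (cmod ((complex_of_real t + z) * poly q (complex_of_real t) - 1))\<^sup>2 \<partial>distr \<mu> borel f) < \<epsilon>"
    using res by (auto simp: one_in_multiples_closure_def)
  \<comment> \<open>The error is a polynomial \<open>P\<close>, and \<open>|P|\<^sup>2 = P cnj(P)\<close> is a polynomial on the line.\<close>
  define P where "P = [:z, 1:] * q - 1"
  have P: "(complex_of_real t + z) * poly q (complex_of_real t) - 1 = poly P (complex_of_real t)" for t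
    by (simp add: P_def algebra_simps)
  define I where "I = (\<lambda>M. \<integral>t. (cmod (poly P (complex_of_real t)))\<^sup>2 \<partial>distr M borel f)"
  have I: "complex_of_real (I M) = moment_functional M (\<lambda>x. poly (P * map_poly cnj P) (complex_of_real (f x)))"
    if M: "M \<in> moment_measures" for M
  proof -
    have fM: "f \<in> borel_measurable M"
      by (rule borel_measurable_moment_measure[OF M borel_measurable_real_polynomial_function[OF f]])
    have "complex_of_real (I M) = (\<integral>t. poly (P * map_poly cnj P) (complex_of_real t) \<partial>distr M borel f)"
      unfolding I_def cmod_poly_square[symmetric] by (simp only: integral_complex_of_real)
    also have "\<dots> = moment_functional M (\<lambda>x. poly (P * map_poly cnj P) (complex_of_real (f x)))"
      unfolding moment_functional_def by (rule integral_distr[OF fM borel_measurable_complex_poly])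
    finally show ?thesis .
  qed
  have "polynomial_function (\<lambda>x. poly (P * map_poly cnj P) (complex_of_real (f x)))"
    by (rule polynomial_function_poly_comp[OF f])
  then have "complex_of_real (I \<nu>) = complex_of_real (I \<mu>)"
    using eq unfolding I[OF mom(1)] I[OF mom(2)] moment_equivalent_def by blast
  then have "I \<nu> = I \<mu>" by simp
  then show "\<exists>q. \<forall>M\<in>{distr \<mu> borel f, distr \<nu> borel f}.
      (\<integral>t. (cmod ((complex_of_real t + z) * poly q (complex_of_real t) - 1))\<^sup>2 \<partial>M) < \<epsilon>"
    using q by (intro exI[of _ q]) (simp add: P I_def)
qed

lemma indicator_poly_approx:
  fixes \<mu> \<nu> :: "'a::euclidean_space measure"
  assumes mom: "\<mu> \<in> moment_measures" "\<nu> \<in> moment_measures" and eq: "\<nu> \<cong>\<^sub>m \<mu>"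
    and f: "real_polynomial_function f" and z: "z \<notin> \<real>" and res: "one_in_multiples_closure (distr \<mu> borel f) z"
    and A: "A \<in> sets borel" and e: "\<epsilon> > 0"
  obtains Q where "\<And>M. M \<in> {\<mu>, \<nu>} \<Longrightarrow>
    (\<integral>x. (cmod (complex_of_real (indicat_real A (f x)) - poly Q (complex_of_real (f x))))\<^sup>2 \<partial>M) < \<epsilon>"
proof -
  interpret one_jointly_approximable "{distr \<mu> borel f, distr \<nu> borel f}" z
    by (rule one_jointly_approximable_distr[OF mom eq f z res])
  from joint_L2_closureD(2)[OF borel_set_in_closure[OF A] e] obtain Q where
    Q: "\<forall>M\<in>{distr \<mu> borel f, distr \<nu> borel f}.
      (\<integral>t. (cmod (complex_of_real (indicat_real A t) - poly Q (complex_of_real t)))\<^sup>2 \<partial>M) < \<epsilon>"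
    by (elim bexE poly_functionsE) simp
  show thesis
  proof (rule that)
    fix M assume M: "M \<in> {\<mu>, \<nu>}"
    then have mM: "M \<in> moment_measures" using mom by auto
    have fM: "f \<in> borel_measurable M"
      by (rule borel_measurable_moment_measure[OF mM borel_measurable_real_polynomial_function[OF f]])
    have "(\<integral>t. (cmod (complex_of_real (indicat_real A t) - poly Q (complex_of_real t)))\<^sup>2 \<partial>distr M borel f) =
        (\<integral>x. (cmod (complex_of_real (indicat_real A (f x)) - poly Q (complex_of_real (f x))))\<^sup>2 \<partial>M)"
    proof (rule integral_distr[OF fM])
      note [measurable] = A borel_measurable_complex_poly
      show "(\<lambda>t. (cmod (complex_of_real (indicat_real A t) - poly Q (complex_of_real t)))\<^sup>2) \<in> borel_measurable borel"
        by measurable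
    qed
    then show "(\<integral>x. (cmod (complex_of_real (indicat_real A (f x)) - poly Q (complex_of_real (f x))))\<^sup>2 \<partial>M) < \<epsilon>"
      using Q M by auto
  qed
qed

text \<open>
A weighted arithmetic-geometric mean inequality; it serves in place of the Cauchy--Schwarz
inequality to bound an \<open>L\<^sup>1\<close> norm by two \<open>L\<^sup>2\<close> norms.
\<close>

lemma product_le_squares:
  fixes a b d :: real
  assumes "d > 0"
  shows "a * b \<le> d * a\<^sup>2 + b\<^sup>2 / d"
proof -
  have "0 \<le> (d * a - b)\<^sup>2 + (d * a)\<^sup>2 + b\<^sup>2" by simp
  then have "2 * (d * (a * b)) \<le> 2 * (d * (d * a\<^sup>2 + b\<^sup>2 / d))"
    using assms by (simp add: power2_eq_square algebra_simps)
  then show ?thesis using assms by simp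
qed

definition joint_L1_approximable :: "'a::euclidean_space measure set \<Rightarrow> ('a \<Rightarrow> complex) \<Rightarrow> bool" where
  "joint_L1_approximable \<M> g \<longleftrightarrow> (\<forall>M\<in>\<M>. integrable M g) \<and>
     (\<forall>\<epsilon>>0. \<exists>p. polynomial_function p \<and> (\<forall>M\<in>\<M>. (\<integral>x. cmod (g x - p x) \<partial>M) < \<epsilon>))"

text \<open>
The polynomial factor \<open>p\<close> makes the induction work.  To add the coordinate \<open>j\<close>, its indicator is
replaced by a polynomial \<open>q\<close> in \<open>f j\<close> at the cost of \<open>\<integral>|p| |i - q|\<close>, which is small because \<open>p\<close> is
a fixed square integrable function; then the induction hypothesis is used for \<open>p q\<close>.  One gets
\<open>L\<^sup>1\<close> approximation only, which is enough to compare integrals.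
\<close>

lemma indicator_product_L1_approximable:
  fixes \<mu> \<nu> :: "'a::euclidean_space measure"
  assumes mom: "\<mu> \<in> moment_measures" "\<nu> \<in> moment_measures" and eq: "\<nu> \<cong>\<^sub>m \<mu>"
    and J: "finite J"
    and f: "\<And>k. k \<in> J \<Longrightarrow> real_polynomial_function (f k)"
    and res: "\<And>k. k \<in> J \<Longrightarrow> \<exists>z. z \<notin> \<real> \<and> one_in_multiples_closure (distr \<mu> borel (f k)) z"
    and A: "\<And>k. k \<in> J \<Longrightarrow> A k \<in> sets borel" and p: "polynomial_function p"
  shows "joint_L1_approximable {\<mu>, \<nu>} (\<lambda>x. p x * (\<Prod>k\<in>J. complex_of_real (indicat_real (A k) (f k x))))"
  using J f res A p
proof (induction J arbitrary: p rule: finite_induct)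
  case empty
  have "(\<forall>M\<in>{\<mu>, \<nu>}. integrable M p)"
    using integrable_polynomial_function(1)[OF _ empty.prems(4)] mom by blast
  then show ?case
    unfolding joint_L1_approximable_def using empty.prems(4) by (auto intro!: exI[of _ p])
next
  case (insert j J)
  define e where "e = (\<lambda>x. \<Prod>k\<in>J. complex_of_real (indicat_real (A k) (f k x)))"
  define i where "i = (\<lambda>x. complex_of_real (indicat_real (A j) (f j x)))"
  have momM: "M \<in> moment_measures" if "M \<in> {\<mu>, \<nu>}" for M using that mom by auto
  have fj: "real_polynomial_function (f j)" using insert.prems by simp
  obtain z where z: "z \<notin> \<real>" "one_in_multiples_closure (distr \<mu> borel (f j)) z"
    using insert.prems(2)[of j] by auto
  have IH: "joint_L1_approximable {\<mu>, \<nu>} (\<lambda>x. p x * e x)" if "polynomial_function p" for p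
    unfolding e_def by (rule insert.IH) (use insert.prems that in auto)
  have e1: "cmod (e x) \<le> 1" for x
    unfolding e_def prod_norm[symmetric] by (rule prod_le_1) (simp add: indicator_def)
  have i1: "cmod (i x) \<le> 1" for x by (simp add: i_def indicator_def)
  have meas: "e \<in> borel_measurable M" "i \<in> borel_measurable M" if M: "M \<in> {\<mu>, \<nu>}" for M
  proof -
    have "(\<lambda>x. complex_of_real (indicat_real (A k) (f k x))) \<in> borel_measurable M" if "k \<in> insert j J" for k
    proof -
      have [measurable]: "f k \<in> borel_measurable M" "A k \<in> sets borel"
        using borel_measurable_moment_measure[OF momM[OF M] borel_measurable_real_polynomial_function]
          insert.prems that by auto
      show ?thesis by measurable
    qed
    then show "e \<in> borel_measurable M" "i \<in> borel_measurable M"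
      unfolding e_def i_def by auto
  qed
  have bounded_int: "integrable M (\<lambda>x. g x * h x)"
    if "integrable M g" "h \<in> borel_measurable M" "\<And>x. cmod (h x) \<le> 1" for g h M
  proof (rule Bochner_Integration.integrable_bound[OF that(1)])
    show "(\<lambda>x. g x * h x) \<in> borel_measurable M"
      using borel_measurable_integrable[OF that(1)] that(2) by simp
    show "AE x in M. norm (g x * h x) \<le> norm (g x)"
      by (intro AE_I2) (simp add: norm_mult mult_left_le that(3))
  qed
  have goal_fun: "(\<lambda>x. p x * (\<Prod>k\<in>insert j J. complex_of_real (indicat_real (A k) (f k x)))) = (\<lambda>x. p x * e x * i x)"
    using insert.hyps by (simp add: e_def i_def mult_ac)
  have int: "integrable M (\<lambda>x. p x * e x * i x)" if M: "M \<in> {\<mu>, \<nu>}" for M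
    by (intro bounded_int integrable_polynomial_function(1)[OF momM[OF M] insert.prems(4)] meas[OF M] e1 i1)
  have "\<exists>r. polynomial_function r \<and> (\<forall>M\<in>{\<mu>, \<nu>}. (\<integral>x. cmod (p x * e x * i x - r x) \<partial>M) < \<epsilon>)"
    if \<epsilon>: "\<epsilon> > 0" for \<epsilon>
  proof -
    define C where "C = (\<integral>x. (cmod (p x))\<^sup>2 \<partial>\<mu>) + (\<integral>x. (cmod (p x))\<^sup>2 \<partial>\<nu>)"
    have nn: "0 \<le> (\<integral>x. (cmod (p x))\<^sup>2 \<partial>M)" for M by simp
    have C: "0 \<le> C" "\<And>M. M \<in> {\<mu>, \<nu>} \<Longrightarrow> (\<integral>x. (cmod (p x))\<^sup>2 \<partial>M) \<le> C"
      using nn[of \<mu>] nn[of \<nu>] by (auto simp: C_def)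
    \<comment> \<open>The weight \<open>d\<close> gives \<open>d \<integral>|p|\<^sup>2 \<le> \<epsilon>/4\<close>; then \<open>q\<close> is chosen so close that the other term is at most \<open>\<epsilon>/4\<close>.\<close>
    define d where "d = \<epsilon> / (4 * (C + 1))"
    have d: "d > 0" "d * C \<le> \<epsilon> / 4" using \<epsilon> C(1) by (simp_all add: d_def field_simps)
    have "d * \<epsilon> / 4 > 0" using d \<epsilon> by simp
    then obtain Q where Q: "\<And>M. M \<in> {\<mu>, \<nu>} \<Longrightarrow>
        (\<integral>x. (cmod (complex_of_real (indicat_real (A j) (f j x)) - poly Q (complex_of_real (f j x))))\<^sup>2 \<partial>M) < d * \<epsilon> / 4"
      using indicator_poly_approx[OF mom eq fj z insert.prems(3)[of j]] by blast
    define q where "q = (\<lambda>x. poly Q (complex_of_real (f j x)))"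
    have q: "polynomial_function q" unfolding q_def by (rule polynomial_function_poly_comp[OF fj])
    have pq: "polynomial_function (\<lambda>x. p x * q x)"
      by (rule polynomial_function_complex_mult[OF insert.prems(4) q])
    obtain r where r: "polynomial_function r" "\<And>M. M \<in> {\<mu>, \<nu>} \<Longrightarrow> (\<integral>x. cmod (p x * q x * e x - r x) \<partial>M) < \<epsilon> / 2"
      using IH[OF pq] \<epsilon> unfolding joint_L1_approximable_def by (metis half_gt_zero)
    have "(\<integral>x. cmod (p x * e x * i x - r x) \<partial>M) < \<epsilon>" if M: "M \<in> {\<mu>, \<nu>}" for M
    proof -
      note ip = integrable_polynomial_function[OF momM[OF M]]
      have int_pq: "integrable M (\<lambda>x. p x * q x * e x)"
        by (intro bounded_int ip(1)[OF pq] meas[OF M] e1)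
      have iL: "i \<in> L2_functions M"
        by (rule L2_functions_bound[where w = "\<lambda>_. 1"])
          (use meas[OF M] i1 finite_measure.integrable_const[OF moment_measures_finite[OF momM[OF M]]]
            in \<open>auto intro: power_le_one\<close>)
      have qL: "q \<in> L2_functions M"
        by (intro L2_functionsI ip(2)[OF q] borel_measurable_integrable[OF ip(1)[OF q]])
      have iq: "integrable M (\<lambda>x. (cmod (i x - q x))\<^sup>2)"
        by (rule L2_functions_integrable[OF L2_functions_diff[OF iL qL]])
      have "(\<integral>x. cmod (p x * e x * i x - p x * q x * e x) \<partial>M) \<le>
          (\<integral>x. d * (cmod (p x))\<^sup>2 + (cmod (i x - q x))\<^sup>2 / d \<partial>M)"
      proof (rule integral_mono)
        show "integrable M (\<lambda>x. cmod (p x * e x * i x - p x * q x * e x))"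
          using int[OF M] int_pq by simp
        show "integrable M (\<lambda>x. d * (cmod (p x))\<^sup>2 + (cmod (i x - q x))\<^sup>2 / d)"
          using ip(2)[OF insert.prems(4)] iq by simp
        fix x
        have "p x * e x * i x - p x * q x * e x = e x * (p x * (i x - q x))"
          by (simp add: algebra_simps)
        then have "cmod (p x * e x * i x - p x * q x * e x) \<le> cmod (p x) * cmod (i x - q x)"
          using e1[of x] by (simp add: norm_mult mult_left_le_one_le)
        then show "cmod (p x * e x * i x - p x * q x * e x) \<le> d * (cmod (p x))\<^sup>2 + (cmod (i x - q x))\<^sup>2 / d"
          using product_le_squares[OF d(1), of "cmod (p x)" "cmod (i x - q x)"] by linarith
      qed
      also have "\<dots> = d * (\<integral>x. (cmod (p x))\<^sup>2 \<partial>M) + (\<integral>x. (cmod (i x - q x))\<^sup>2 \<partial>M) / d"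
        using ip(2)[OF insert.prems(4)] iq by simp
      also have "\<dots> \<le> \<epsilon> / 4 + \<epsilon> / 4"
      proof (rule add_mono)
        have "d * (\<integral>x. (cmod (p x))\<^sup>2 \<partial>M) \<le> d * C" using d(1) C(2)[OF M] by simp
        then show "d * (\<integral>x. (cmod (p x))\<^sup>2 \<partial>M) \<le> \<epsilon> / 4" using d(2) by linarith
        show "(\<integral>x. (cmod (i x - q x))\<^sup>2 \<partial>M) / d \<le> \<epsilon> / 4"
          using Q[OF M] d(1) unfolding i_def q_def by (simp add: field_simps)
      qed
      finally have 1: "(\<integral>x. cmod (p x * e x * i x - p x * q x * e x) \<partial>M) \<le> \<epsilon> / 2" by simp
      have "(\<integral>x. cmod (p x * e x * i x - r x) \<partial>M) \<le>
          (\<integral>x. cmod (p x * e x * i x - p x * q x * e x) + cmod (p x * q x * e x - r x) \<partial>M)"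
      proof (rule integral_mono)
        show "integrable M (\<lambda>x. cmod (p x * e x * i x - r x))" using int[OF M] ip(1)[OF r(1)] by simp
        show "integrable M (\<lambda>x. cmod (p x * e x * i x - p x * q x * e x) + cmod (p x * q x * e x - r x))"
          using int[OF M] int_pq ip(1)[OF r(1)] by simp
        fix x show "cmod (p x * e x * i x - r x) \<le> cmod (p x * e x * i x - p x * q x * e x) + cmod (p x * q x * e x - r x)"
          using norm_triangle_ineq[of "p x * e x * i x - p x * q x * e x" "p x * q x * e x - r x"] by simp
      qed
      also have "\<dots> = (\<integral>x. cmod (p x * e x * i x - p x * q x * e x) \<partial>M) + (\<integral>x. cmod (p x * q x * e x - r x) \<partial>M)"
        using int[OF M] int_pq ip(1)[OF r(1)] by simp
      finally show ?thesis using 1 r(2)[OF M] by linarith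
    qed
    then show ?thesis using r(1) by blast
  qed
  then show ?case unfolding goal_fun joint_L1_approximable_def using int by blast
qed

lemma joint_L1_approximable_integral_eq:
  fixes \<mu> \<nu> :: "'a::euclidean_space measure"
  assumes mom: "\<mu> \<in> moment_measures" "\<nu> \<in> moment_measures" and eq: "\<nu> \<cong>\<^sub>m \<mu>"
    and g: "joint_L1_approximable {\<mu>, \<nu>} g"
  shows "integral\<^sup>L \<nu> g = integral\<^sup>L \<mu> g"
proof -
  have "cmod (integral\<^sup>L \<nu> g - integral\<^sup>L \<mu> g) \<le> 0 + \<epsilon>" if e: "\<epsilon> > 0" for \<epsilon>
  proof -
    obtain p where p: "polynomial_function p" "\<And>M. M \<in> {\<mu>, \<nu>} \<Longrightarrow> (\<integral>x. cmod (g x - p x) \<partial>M) < \<epsilon> / 2"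
      using g e unfolding joint_L1_approximable_def by (metis half_gt_zero)
    have close: "cmod (integral\<^sup>L M g - integral\<^sup>L M p) < \<epsilon> / 2" if M: "M \<in> {\<mu>, \<nu>}" "M \<in> moment_measures" for M
    proof -
      have "integrable M g" using g M unfolding joint_L1_approximable_def by blast
      then have "integral\<^sup>L M g - integral\<^sup>L M p = (\<integral>x. g x - p x \<partial>M)"
        using integrable_polynomial_function(1)[OF M(2) p(1)] by simp
      also have "cmod \<dots> \<le> (\<integral>x. cmod (g x - p x) \<partial>M)" by (rule integral_norm_bound)
      finally show ?thesis using p(2)[OF M(1)] by simp
    qed
    have "integral\<^sup>L \<nu> p = integral\<^sup>L \<mu> p"
      using eq p(1) by (simp add: moment_equivalent_def moment_functional_def)
    then have "integral\<^sup>L \<nu> g - integral\<^sup>L \<mu> g =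
        (integral\<^sup>L \<nu> g - integral\<^sup>L \<nu> p) - (integral\<^sup>L \<mu> g - integral\<^sup>L \<mu> p)" by simp
    then have "cmod (integral\<^sup>L \<nu> g - integral\<^sup>L \<mu> g) \<le>
        cmod (integral\<^sup>L \<nu> g - integral\<^sup>L \<nu> p) + cmod (integral\<^sup>L \<mu> g - integral\<^sup>L \<mu> p)"
      by (simp only: norm_triangle_ineq4)
    then show ?thesis using close[of \<mu>] close[of \<nu>] mom by simp
  qed
  then have "cmod (integral\<^sup>L \<nu> g - integral\<^sup>L \<mu> g) \<le> 0" by (rule field_le_epsilon)
  then show ?thesis by simp
qed

text \<open>
Integrals of jointly \<open>L\<^sup>1\<close>-approximable functions are determined by moments.  With \<open>J\<close> a singleton and
\<open>f\<close> the identity this is determinacy on the line.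
\<close>

theorem measure_cylinder_eq:
  fixes \<mu> \<nu> :: "'a::euclidean_space measure"
  assumes mom: "\<mu> \<in> moment_measures" "\<nu> \<in> moment_measures" and eq: "\<nu> \<cong>\<^sub>m \<mu>"
    and J: "finite J"
    and f: "\<And>k. k \<in> J \<Longrightarrow> real_polynomial_function (f k)"
    and res: "\<And>k. k \<in> J \<Longrightarrow> \<exists>z. z \<notin> \<real> \<and> one_in_multiples_closure (distr \<mu> borel (f k)) z"
    and A: "\<And>k. k \<in> J \<Longrightarrow> A k \<in> sets borel"
  shows "emeasure \<nu> {x. \<forall>k\<in>J. f k x \<in> A k} = emeasure \<mu> {x. \<forall>k\<in>J. f k x \<in> A k}"
proof -
  define B where "B = {x. \<forall>k\<in>J. f k x \<in> A k}"
  have B: "B \<in> sets borel"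
  proof -
    have [measurable]: "f k \<in> borel_measurable borel" "A k \<in> sets borel" if "k \<in> J" for k
      using borel_measurable_real_polynomial_function[OF f[OF that]] A[OF that] by auto
    have "B = (\<Inter>k\<in>J. f k -` A k) \<inter> UNIV" by (auto simp: B_def)
    also have "\<dots> \<in> sets borel"
      using J \<open>\<And>k. k \<in> J \<Longrightarrow> A k \<in> sets borel\<close>
      by (cases "J = {}") (auto intro!: sets.finite_INT measurable_sets_borel[where M = borel])
    finally show ?thesis .
  qed
  have ind: "(\<lambda>x. 1 * (\<Prod>k\<in>J. complex_of_real (indicat_real (A k) (f k x)))) = (\<lambda>x. complex_of_real (indicat_real B x))"
  proof
    fix x
    show "1 * (\<Prod>k\<in>J. complex_of_real (indicat_real (A k) (f k x))) = complex_of_real (indicat_real B x)"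
    proof (cases "x \<in> B")
      case True
      then show ?thesis by (auto simp: B_def)
    next
      case False
      then obtain k where "k \<in> J" "f k x \<notin> A k" by (auto simp: B_def)
      then have "(\<Prod>k\<in>J. complex_of_real (indicat_real (A k) (f k x))) = 0"
        using J by (intro prod_zero bexI[of _ k]) auto
      then show ?thesis using False by simp
    qed
  qed
  have int: "(\<integral>x. complex_of_real (indicat_real B x) \<partial>M) = complex_of_real (measure M B)"
    if "M \<in> moment_measures" for M
  proof -
    have "sets M = sets borel" using that by (simp add: moment_measures_def)
    then have "space M = UNIV" using sets_eq_imp_space_eq by fastforce
    then show ?thesis by simp
  qed
  have "joint_L1_approximable {\<mu>, \<nu>} (\<lambda>x. 1 * (\<Prod>k\<in>J. complex_of_real (indicat_real (A k) (f k x))))"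
    by (rule indicator_product_L1_approximable[OF mom eq J f res A polynomial_function_const])
  from joint_L1_approximable_integral_eq[OF mom eq this]
  have "measure \<nu> B = measure \<mu> B" unfolding ind int[OF mom(1)] int[OF mom(2)] by simp
  then show ?thesis
    using finite_measure.emeasure_eq_measure[OF moment_measures_finite[OF mom(1)]]
      finite_measure.emeasure_eq_measure[OF moment_measures_finite[OF mom(2)]]
    by (simp add: B_def)
qed

section \<open>The equivalent conditions and determinacy on the set\<close>

lemma one_approximable_iff:
  fixes \<mu> :: "'a::euclidean_space measure"
  assumes mom: "\<mu> \<in> moment_measures" and f: "real_polynomial_function f"
  shows "one_approximable \<mu> f \<longleftrightarrow> (\<exists>z. z \<notin> \<real> \<and> one_in_multiples_closure (distr \<mu> borel f) z)"
proof -
  define d where "d = (\<lambda>z q. \<integral>t. (cmod ((complex_of_real t + z) * poly q (complex_of_real t) - 1))\<^sup>2 \<partial>distr \<mu> borel f)"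
  have fM: "f \<in> borel_measurable \<mu>"
    by (rule borel_measurable_moment_measure[OF mom borel_measurable_real_polynomial_function[OF f]])
  have norm: "moment_norm \<mu> (\<lambda>x. (complex_of_real (f x) + z) * poly q (complex_of_real (f x)) - 1) = sqrt (d z q)" for z q
  proof -
    have "(\<lambda>t. (cmod ((complex_of_real t + z) * poly q (complex_of_real t) - 1))\<^sup>2) \<in> borel_measurable borel"
      by (intro borel_measurable_continuous_onI continuous_intros)
    then have "d z q = (\<integral>x. (cmod ((complex_of_real (f x) + z) * poly q (complex_of_real (f x)) - 1))\<^sup>2 \<partial>\<mu>)"
      unfolding d_def by (rule integral_distr[OF fM])
    then show ?thesis
      unfolding moment_norm_def moment_inner_def moment_functional_def complex_norm_square[symmetric]
      by (simp only: of_real_power[symmetric] integral_complex_of_real Re_complex_of_real)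
  qed
  have d_fold: "(\<integral>t. (cmod ((complex_of_real t + z) * poly q (complex_of_real t) - 1))\<^sup>2 \<partial>distr \<mu> borel f) = d z q" for z q
    by (simp add: d_def)
  have nonneg: "0 \<le> d z q" for z q by (simp add: d_def)
  have "(\<exists>q. (\<lambda>n. sqrt (d z (q n))) \<longlonglongrightarrow> 0) \<longleftrightarrow> (\<forall>\<epsilon>>0. \<exists>q. d z q < \<epsilon>)" for z
  proof
    assume "\<exists>q. (\<lambda>n. sqrt (d z (q n))) \<longlonglongrightarrow> 0"
    then obtain q where q: "(\<lambda>n. sqrt (d z (q n))) \<longlonglongrightarrow> 0" by blast
    show "\<forall>\<epsilon>>0. \<exists>q. d z q < \<epsilon>"
    proof (intro allI impI)
      fix \<epsilon> :: real assume e: "\<epsilon> > 0"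
      then have "\<forall>\<^sub>F n in sequentially. sqrt (d z (q n)) < sqrt \<epsilon>"
        by (intro order_tendstoD(2)[OF q]) simp
      then show "\<exists>q. d z q < \<epsilon>" by (auto simp: eventually_sequentially)
    qed
  next
    assume small: "\<forall>\<epsilon>>0. \<exists>q. d z q < \<epsilon>"
    have "\<forall>n. \<exists>q. d z q < 1 / real (Suc n)" using small by simp
    then obtain q where q: "\<And>n. d z (q n) < 1 / real (Suc n)" by metis
    have "(\<lambda>n. d z (q n)) \<longlonglongrightarrow> 0"
      by (rule Lim_null_comparison[OF _ LIMSEQ_Suc[OF lim_1_over_n]])
        (use q nonneg in \<open>auto intro!: always_eventually less_imp_le\<close>)
    from tendsto_real_sqrt[OF this] show "\<exists>q. (\<lambda>n. sqrt (d z (q n))) \<longlonglongrightarrow> 0" by auto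
  qed
  then show ?thesis
    unfolding one_approximable_def moment_tendsto_def norm one_in_multiples_closure_def d_fold by simp
qed

lemma image_determinate_iff:
  fixes \<mu> :: "'a::euclidean_space measure"
  assumes mom: "\<mu> \<in> moment_measures" and f: "real_polynomial_function f"
  shows "image_determinate \<mu> f \<longleftrightarrow> (\<exists>z. z \<notin> \<real> \<and> one_in_multiples_closure (distr \<mu> borel f) z)"
proof
  show "image_determinate \<mu> f \<Longrightarrow> \<exists>z. z \<notin> \<real> \<and> one_in_multiples_closure (distr \<mu> borel f) z"
    unfolding image_determinate_def by (rule determinate_imp_one_in_multiples_closure)
  assume res: "\<exists>z. z \<notin> \<real> \<and> one_in_multiples_closure (distr \<mu> borel f) z"
  define \<rho> where "\<rho> = distr \<mu> borel f"
  have mom\<rho>: "\<rho> \<in> moment_measures" unfolding \<rho>_def by (rule distr_moment_measures[OF mom f])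
  have "\<nu> = \<rho>" if \<nu>: "\<nu> \<in> moment_measures" and eq: "\<nu> \<cong>\<^sub>m \<rho>" for \<nu>
  proof (rule measure_eqI)
    have sets: "sets \<rho> = sets borel" "sets \<nu> = sets borel"
      using mom\<rho> \<nu> by (auto simp: moment_measures_def)
    then show "sets \<nu> = sets \<rho>" by simp
    fix A assume "A \<in> sets \<nu>"
    then have A: "A \<in> sets borel" using sets by simp
    have "emeasure \<nu> {t. \<forall>k\<in>{()}. t \<in> A} = emeasure \<rho> {t. \<forall>k\<in>{()}. t \<in> A}"
      by (rule measure_cylinder_eq[OF mom\<rho> \<nu> eq, where f = "\<lambda>_ t. t"])
        (use A res distr_id2[of borel \<rho>] sets in \<open>auto simp: \<rho>_def intro: real_polynomial_function.intros(1)\<close>)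
    then show "emeasure \<nu> A = emeasure \<rho> A" by simp
  qed
  then show "image_determinate \<mu> f"
    using mom\<rho> by (auto simp: image_determinate_def determinate_on_def moment_measures_on_def \<rho>_def)
qed

text \<open>
The constant \<open>1\<close> is in \<open>L\<^sup>2\<close>, so density gives the condition.  Conversely the polynomials are dense,
and a polynomial \<open>(t + z) r(t) + c\<close> is approximated by \<open>(t + z)(r(t) + c q(t))\<close> when \<open>(t + z) q(t)\<close> is
close to \<open>1\<close>.
\<close>

lemma image_multiples_dense_iff:
  fixes \<mu> :: "'a::euclidean_space measure"
  assumes mom: "\<mu> \<in> moment_measures" and f: "real_polynomial_function f"
  shows "image_multiples_dense \<mu> f \<longleftrightarrow> (\<exists>z. z \<notin> \<real> \<and> one_in_multiples_closure (distr \<mu> borel f) z)"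
proof -
  define \<rho> where "\<rho> = distr \<mu> borel f"
  have mom\<rho>: "\<rho> \<in> moment_measures" unfolding \<rho>_def by (rule distr_moment_measures[OF mom f])
  define S where "S = (\<lambda>z. range (\<lambda>(q :: complex poly) t. (complex_of_real t + z) * poly q (complex_of_real t)))"
  have mult: "(\<lambda>t. (complex_of_real t + z) * poly q (complex_of_real t)) = (\<lambda>t. poly ([:z, 1:] * q) (complex_of_real t))" for z q
    by (simp add: algebra_simps)
  have "L2_dense \<rho> (S z) \<longleftrightarrow> one_in_multiples_closure \<rho> z" if z: "z \<notin> \<real>" for z
  proof
    assume dense: "L2_dense \<rho> (S z)"
    show "one_in_multiples_closure \<rho> z"
      unfolding one_in_multiples_closure_def
    proof (intro allI impI)
      fix \<epsilon> :: real assume e: "\<epsilon> > 0"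
      have one: "(\<lambda>_. 1) \<in> L2_functions \<rho>"
        using L2_functions_complex_poly[OF mom\<rho>, of 1] by simp
      have "\<exists>g\<in>S z. sqrt (\<integral>t. (cmod (1 - g t))\<^sup>2 \<partial>\<rho>) < sqrt \<epsilon>"
        using dense[unfolded L2_dense_def, THEN conjunct2, rule_format, OF one, of "sqrt \<epsilon>"] e by simp
      then obtain q where "(\<integral>t. (cmod (1 - (complex_of_real t + z) * poly q (complex_of_real t)))\<^sup>2 \<partial>\<rho>) < \<epsilon>"
        by (auto simp: S_def)
      then show "\<exists>q. (\<integral>t. (cmod ((complex_of_real t + z) * poly q (complex_of_real t) - 1))\<^sup>2 \<partial>\<rho>) < \<epsilon>"
        by (intro exI[of _ q]) (simp add: norm_minus_commute)
    qed
  next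
    assume res: "one_in_multiples_closure \<rho> z"
    interpret one_jointly_approximable "{\<rho>}" z
      by standard (use mom\<rho> z res in \<open>simp_all add: one_in_multiples_closure_def\<close>)
    show "L2_dense \<rho> (S z)"
      unfolding L2_dense_def
    proof (intro conjI ballI allI impI)
      show "S z \<subseteq> L2_functions \<rho>"
        unfolding S_def mult using L2_functions_complex_poly[OF mom\<rho>] by (intro image_subsetI)
      fix h and \<epsilon> :: real assume h: "h \<in> L2_functions \<rho>" and e: "\<epsilon> > 0"
      have "sets \<rho> = sets borel" by (rule moment_measures_real(1)[OF mom\<rho>])
      then have "h \<in> borel_measurable borel"
        using L2_functions_measurable[OF h] measurable_cong_sets[of \<rho> borel] by blast
      then have hH: "h \<in> H" by (rule polynomials_dense) (use h in simp)
      have "0 < \<epsilon>\<^sup>2 / 4" using e by simp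
      from joint_L2_closureD(2)[OF hH this] obtain p where
        p: "(\<integral>t. (cmod (h t - poly p (complex_of_real t)))\<^sup>2 \<partial>\<rho>) < \<epsilon>\<^sup>2 / 4"
        by (elim bexE poly_functionsE) simp
      define c where "c = poly p (- z)"
      define r where "r = synthetic_div p (- z)"
      have peq: "p = [:z, 1:] * r + [:c:]"
        using synthetic_div_correct'[of "- z" p] by (simp add: r_def c_def)
      have pr: "poly p w = (w + z) * poly r w + c" for w
        by (subst peq) (simp add: algebra_simps)
      have pos: "0 < (cmod c)\<^sup>2 + 1" by (simp add: add_nonneg_pos)
      have "\<epsilon>\<^sup>2 / (4 * ((cmod c)\<^sup>2 + 1)) > 0" using e pos by simp
      then obtain q where q: "(\<integral>t. (cmod ((complex_of_real t + z) * poly q (complex_of_real t) - 1))\<^sup>2 \<partial>\<rho>)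
          < \<epsilon>\<^sup>2 / (4 * ((cmod c)\<^sup>2 + 1))"
        using res unfolding one_in_multiples_closure_def by blast
      define b where "b = (\<lambda>t. 1 - (complex_of_real t + z) * poly q (complex_of_real t))"
      have b: "b = (\<lambda>t. poly (1 - [:z, 1:] * q) (complex_of_real t))" by (auto simp: b_def algebra_simps)
      have bL: "b \<in> L2_functions \<rho>" unfolding b by (rule L2_functions_complex_poly[OF mom\<rho>])
      define g where "g = (\<lambda>t. (complex_of_real t + z) * poly (r + smult c q) (complex_of_real t))"
      have gS: "g \<in> S z" unfolding g_def S_def by (rule rangeI)
      have hg: "h t - g t = (h t - poly p (complex_of_real t)) + c * b t" for t
        by (simp add: g_def b_def pr algebra_simps)
      have cancel: "a * (\<epsilon>\<^sup>2 / (4 * a)) = \<epsilon>\<^sup>2 / 4" if "0 < a" for a using that by simp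
      have "(\<integral>t. (cmod (h t - g t))\<^sup>2 \<partial>\<rho>) \<le>
          2 * (\<integral>t. (cmod (h t - poly p (complex_of_real t)))\<^sup>2 \<partial>\<rho>) + 2 * (\<integral>t. (cmod (c * b t))\<^sup>2 \<partial>\<rho>)"
        unfolding hg by (intro L2_functions_add(2) L2_functions_diff h L2_functions_scale bL L2_functions_complex_poly mom\<rho>)
      also have "(\<integral>t. (cmod (c * b t))\<^sup>2 \<partial>\<rho>) = (cmod c)\<^sup>2 * (\<integral>t. (cmod (b t))\<^sup>2 \<partial>\<rho>)"
        by (simp add: norm_mult power_mult_distrib)
      also have "\<dots> \<le> ((cmod c)\<^sup>2 + 1) * (\<epsilon>\<^sup>2 / (4 * ((cmod c)\<^sup>2 + 1)))"
        by (intro mult_mono) (use q in \<open>simp_all add: b_def norm_minus_commute\<close>)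
      also have "\<dots> = \<epsilon>\<^sup>2 / 4" by (rule cancel[OF pos])
      finally have "(\<integral>t. (cmod (h t - g t))\<^sup>2 \<partial>\<rho>) < \<epsilon>\<^sup>2" using p by simp
      then have "sqrt (\<integral>t. (cmod (h t - g t))\<^sup>2 \<partial>\<rho>) < sqrt (\<epsilon>\<^sup>2)" by (rule real_sqrt_less_mono)
      then have "sqrt (\<integral>t. (cmod (h t - g t))\<^sup>2 \<partial>\<rho>) < \<epsilon>" using e by simp
      then show "\<exists>g\<in>S z. sqrt (\<integral>t. (cmod (h t - g t))\<^sup>2 \<partial>\<rho>) < \<epsilon>" using gS by blast
    qed
  qed
  then show ?thesis
    unfolding image_multiples_dense_def \<rho>_def[symmetric] S_def by blast
qed

text \<open>
The complement of the support is a union of open null sets; by the Lindeloef property countably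
many of them suffice.
\<close>

lemma emeasure_outside_support:
  fixes M :: "'a::second_countable_topology measure"
  assumes sets: "sets M = sets borel" and K: "closed K" "measure_support M \<subseteq> K"
  shows "emeasure M (- K) = 0"
proof -
  define F where "F = {U. open U \<and> emeasure M U = 0}"
  obtain F' where F': "F' \<subseteq> F" "countable F'" "\<Union>F' = \<Union>F"
    using Lindelof[of F] by (auto simp: F_def)
  have "- K \<subseteq> \<Union>F"
  proof
    fix x assume "x \<in> - K"
    then have "x \<notin> measure_support M" using K(2) by blast
    then obtain U where "open U" "x \<in> U" "emeasure M U = 0"
      by (auto simp: measure_support_def)
    then show "x \<in> \<Union>F" by (auto simp: F_def)
  qed
  moreover have "\<Union>F' \<in> null_sets M"
  proof -
    have "U \<in> null_sets M" if "U \<in> F'" for U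
      using that F'(1) sets by (auto simp: F_def null_sets_def)
    then show ?thesis using null_sets_UN'[OF F'(2), of "\<lambda>U. U" M] by simp
  qed
  ultimately have "- K \<in> null_sets M"
    using K(1) sets F'(3) by (intro null_sets_subset[of "\<Union>F'" M "- K"]) auto
  then show ?thesis by auto
qed

text \<open>
The image measures agree because lower orthants are cylinder sets.  To return from the image to \<open>K\<close>
it is enough to look at compact sets: up to a null set a compact \<open>C\<close> equals the preimage of the
compact set \<open>\<phi> ` (C \<inter> K)\<close>, and compact intervals determine a finite Borel measure.
\<close>

theorem determinate_on_injective:
  fixes K :: "'a::ordered_euclidean_space set" and \<phi> :: "'a \<Rightarrow> real ^ 'm"
  assumes K: "closed K" and \<mu>: "\<mu> \<in> moment_measures_on K"
    and \<phi>: "\<And>k. real_polynomial_function (\<lambda>x. \<phi> x $ k)" and inj: "inj_on \<phi> K"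
    and res: "\<And>k. \<exists>z. z \<notin> \<real> \<and> one_in_multiples_closure (distr \<mu> borel (\<lambda>x. \<phi> x $ k)) z"
  shows "determinate_on K \<mu>"
  unfolding determinate_on_def
proof (intro conjI ballI impI \<mu>)
  fix \<nu> assume \<nu>: "\<nu> \<in> moment_measures_on K" and eq: "\<nu> \<cong>\<^sub>m \<mu>"
  have mom: "\<mu> \<in> moment_measures" "\<nu> \<in> moment_measures"
    using \<mu> \<nu> by (auto simp: moment_measures_on_def)
  have sets: "sets M = sets borel" if "M \<in> {\<mu>, \<nu>}" for M
    using mom that by (auto simp: moment_measures_def)
  have fin: "finite_measure M" if "M \<in> {\<mu>, \<nu>}" for M
    using mom that moment_measures_finite by auto
  have cont: "continuous_on A \<phi>" for A
  proof -
    have "continuous_on A (\<lambda>x. \<chi> k. \<phi> x $ k)"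
      using \<phi> by (intro continuous_on_vec_lambda continuous_on_polymonial_function)
        (simp add: real_polynomial_function_eq)
    then show ?thesis by simp
  qed
  have \<phi>b: "\<phi> \<in> borel_measurable borel" by (rule borel_measurable_continuous_onI[OF cont])
  have \<phi>M: "\<phi> \<in> borel_measurable M" if "M \<in> {\<mu>, \<nu>}" for M
    by (rule borel_measurable_moment_measure[OF _ \<phi>b]) (use that mom in auto)
  have space: "space M = UNIV" if "M \<in> {\<mu>, \<nu>}" for M
    using sets_eq_imp_space_eq[OF sets[OF that]] by simp
  have image: "distr \<nu> borel \<phi> = distr \<mu> borel \<phi>"
  proof (rule measure_eqI_generator_eq[where E = "range (\<lambda>a :: real ^ 'm. {..a})" and \<Omega> = UNIV
        and A = "\<lambda>n. {..(\<chi> i. real n)}"])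
    show "Int_stable (range (\<lambda>a :: real ^ 'm. {..a}))"
    proof (rule Int_stableI, elim rangeE, simp)
      fix a b :: "real ^ 'm"
      show "{..a} \<inter> {..b} \<in> range atMost" by (rule range_eqI[of _ _ "inf a b"]) auto
    qed
    show "emeasure (distr \<nu> borel \<phi>) X = emeasure (distr \<mu> borel \<phi>) X"
      if X_range: "X \<in> range (\<lambda>a :: real ^ 'm. {..a})" for X
    proof -
      obtain a where X: "X = {..a}" using X_range by (rule rangeE)
      have "emeasure (distr M borel \<phi>) X = emeasure M {x. \<forall>k\<in>UNIV. \<phi> x $ k \<in> {..a $ k}}"
        if M: "M \<in> {\<mu>, \<nu>}" for M
      proof -
        have "\<phi> -` X \<inter> space M = {x. \<forall>k\<in>UNIV. \<phi> x $ k \<in> {..a $ k}}"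
          unfolding X space[OF M] by (auto simp: less_eq_vec_def)
        then show ?thesis by (subst emeasure_distr[OF \<phi>M[OF M]]) (simp_all add: X)
      qed
      then show ?thesis
        using measure_cylinder_eq[OF mom eq, of UNIV "\<lambda>k x. \<phi> x $ k" "\<lambda>k. {..a $ k}"] \<phi> res by simp
    qed
    show "sets (distr \<nu> borel \<phi>) = sigma_sets UNIV (range (\<lambda>a :: real ^ 'm. {..a}))"
      "sets (distr \<mu> borel \<phi>) = sigma_sets UNIV (range (\<lambda>a :: real ^ 'm. {..a}))"
      by (simp_all add: borel_eq_atMost)
    show "(\<Union>n. {..(\<chi> i. real n)}) = (UNIV :: (real ^ 'm) set)"
    proof (intro equalityI subsetI UNIV_I)
      fix x :: "real ^ 'm"
      obtain n :: nat where n: "norm x \<le> real n" using real_arch_simple by blast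
      have "x $ i \<le> real n" for i
        using component_le_norm_cart[of x i] n by linarith
      then show "x \<in> (\<Union>n. {..(\<chi> i. real n)})" by (auto simp: less_eq_vec_def)
    qed
    show "emeasure (distr \<nu> borel \<phi>) {..(\<chi> i. real n)} \<noteq> \<infinity>" for n
      using finite_measure.emeasure_finite[OF finite_measure.finite_measure_distr[OF fin \<phi>M], of \<nu>] by simp
  qed auto
  have compact_eq: "emeasure \<nu> C = emeasure \<mu> C" if C: "compact C" for C
  proof -
    have CK: "compact (C \<inter> K)" using C K by (rule compact_Int_closed)
    have "emeasure M C = emeasure (distr M borel \<phi>) (\<phi> ` (C \<inter> K))" if M: "M \<in> {\<mu>, \<nu>}" for M
    proof -
      have im: "\<phi> ` (C \<inter> K) \<in> sets borel"
        using compact_continuous_image[OF cont CK] by (simp add: compact_imp_closed)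
      have null: "- K \<in> null_sets M"
        using emeasure_outside_support[OF sets[OF M] K] M \<mu> \<nu> K sets[OF M]
        by (auto simp: moment_measures_on_def null_sets_def)
      have pre: "\<phi> -` \<phi> ` (C \<inter> K) \<in> sets M"
        using measurable_sets[OF \<phi>M[OF M] im] by (simp add: space[OF M])
      have "(\<phi> -` \<phi> ` (C \<inter> K)) - (- K) = C - (- K)"
        using inj by (auto simp: inj_on_def)
      then have "emeasure M (\<phi> -` \<phi> ` (C \<inter> K)) = emeasure M C"
        using emeasure_Diff_null_set[OF null pre] emeasure_Diff_null_set[OF null, of C] C sets[OF M]
        by (simp add: compact_imp_closed)
      then show ?thesis using emeasure_distr[OF \<phi>M[OF M] im] by (simp add: space[OF M])
    qed
    then show ?thesis using image by simp
  qed
  show "\<nu> = \<mu>"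
  proof (rule measure_eqI_generator_eq[where E = "range (\<lambda>(a, b). {a..b :: 'a})" and \<Omega> = UNIV
        and A = "\<lambda>n. {- real n *\<^sub>R One..real n *\<^sub>R One}"])
    show "Int_stable (range (\<lambda>(a, b). {a..b :: 'a}))" by (rule Int_stable_intervals)
    show "emeasure \<nu> X = emeasure \<mu> X" if "X \<in> range (\<lambda>(a, b). {a..b :: 'a})" for X
      using that by (auto intro!: compact_eq compact_interval)
    show "sets \<nu> = sigma_sets UNIV (range (\<lambda>(a, b). {a..b :: 'a}))"
      "sets \<mu> = sigma_sets UNIV (range (\<lambda>(a, b). {a..b :: 'a}))"
      using sets by (simp_all add: borel_eq_atLeastAtMost)
    show "(\<Union>n. {- real n *\<^sub>R One..real n *\<^sub>R One}) = (UNIV :: 'a set)"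
    proof (intro equalityI subsetI UNIV_I)
      fix x :: 'a
      obtain n where "x \<in> box (- (real n *\<^sub>R One)) (real n *\<^sub>R One)"
        using UN_box_eq_UNIV[where 'a = 'a] UNIV_I[of x] by blast
      then have "x \<in> {- real n *\<^sub>R One..real n *\<^sub>R One}"
        using box_subset_cbox by (auto simp: cbox_interval[symmetric])
      then show "x \<in> (\<Union>n. {- real n *\<^sub>R One..real n *\<^sub>R One})" by blast
    qed
    show "emeasure \<nu> {- real n *\<^sub>R One..real n *\<^sub>R One} \<noteq> \<infinity>" for n
      using finite_measure.emeasure_finite[OF fin[of \<nu>]] by simp
  qed auto
qed

theorem theorem15:
  fixes K :: "(real ^ 'd) set"
    and \<mu> :: "(real ^ 'd) measure"
    and \<phi> :: "real ^ 'd \<Rightarrow> real ^ 'm"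
  assumes "closed K"
    and "\<mu> \<in> moment_measures_on K"
    and "\<And>k. real_polynomial_function (\<lambda>x. \<phi> x $ k)"
  shows "(\<forall>k. (image_determinate \<mu> (\<lambda>x. \<phi> x $ k) \<longleftrightarrow> one_approximable \<mu> (\<lambda>x. \<phi> x $ k)) \<and>
              (one_approximable \<mu> (\<lambda>x. \<phi> x $ k) \<longleftrightarrow> image_multiples_dense \<mu> (\<lambda>x. \<phi> x $ k))) \<and>
         (inj_on \<phi> K \<and>
          (\<forall>k. image_determinate \<mu> (\<lambda>x. \<phi> x $ k) \<or>
               one_approximable \<mu> (\<lambda>x. \<phi> x $ k) \<or>
               image_multiples_dense \<mu> (\<lambda>x. \<phi> x $ k))
          \<longrightarrow> determinate_on K \<mu>)"
proof -
  have mom: "\<mu> \<in> moment_measures" using assms(2) by (simp add: moment_measures_on_def)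
  note iffs = image_determinate_iff[OF mom assms(3)] one_approximable_iff[OF mom assms(3)]
    image_multiples_dense_iff[OF mom assms(3)]
  show ?thesis
    unfolding iffs using determinate_on_injective[OF assms] by blast
qed

end
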